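(* Let $k\ge 2$ and let $\lambda$ be a self-conjugate Ferrers board. Then the number of symmetric full rook placements on $\lambda$ that avoid the pattern $k\cdots 21$ equals the number of symmetric full rook placements on $\lambda$ that avoid the pattern $(k-1)\cdots 21k$.
   Context: A Ferrers board $\lambda$ is a finite set of cells $(i,j)$ with positive integer coordinates ($i$ = column/abscissa, $j$ = row/height) such that if $(i,j)\in\lambda$, $i'\le i$, $j'\le j$ then $(i',j')\in\lambda$. Its conjugate $\lambda'$ is $\{(j,i):(i,j)\in\lambda\}$; $\lambda$ is self-conjugate if $\lambda=\lambda'$. A full rook placement (placement) on $\lambda$ is a set of cells of $\lambda$ (dots) containing exactly one cell in each row and in each column of $\lambda$ (so $\lambda$ has as many nonempty rows as columns, say $n$). Its associated permutation $\pi\in\mathfrak S_n$ is given by $\pi(i)=j$ iff $(i,j)$ is a dot. The inverse $p'$ of a placement $p$ on $\lambda$ is the placement $\{(j,i):(i,j)\in p\}$ on $\lambda'$; $p$ is symmetric if $p=p'$. For $\tau\in\mathfrak S_m$, the placement $p$ contains $\tau$ if there are $i_1<\cdots<i_m$ such that $\pi_{i_1}\cdots\pi_{i_m}$ is order-isomorphic to $\tau$ and the cell $(i_m,\max_r\pi_{i_r})$ belongs to $\lambda$ (i.e. the dots lie in a rectangular sub-board of $\lambda$); otherwise $p$ avoids $\tau$. The pattern $(k-1)\cdots 21k$ is the permutation $(k-1)(k-2)\cdots 1\,k\in\mathfrak S_k$. *)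

theory Defs
  imports Main "HOL-Combinatorics.Permutations"
begin

text \<open>A cell \<open>(i, j)\<close> has abscissa (column) \<open>i\<close> and height (row) \<open>j\<close>. Hence \<open>Domain L\<close>
  is the set of columns of a board \<open>L\<close>, \<open>Range L\<close> its set of rows, and the conjugate of a
  board and the inverse of a placement are both given by relational converse.\<close>

definition ferrers_board :: "(nat \<times> nat) set \<Rightarrow> bool" where
  "ferrers_board L \<longleftrightarrow> finite L \<and>
     (\<forall>(i, j) \<in> L. 1 \<le> i \<and> 1 \<le> j) \<and>
     (\<forall>i j i' j'. (i, j) \<in> L \<and> 1 \<le> i' \<and> i' \<le> i \<and> 1 \<le> j' \<and> j' \<le> j \<longrightarrow> (i', j') \<in> L)"

definition self_conjugate :: "(nat \<times> nat) set \<Rightarrow> bool" where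
  "self_conjugate L \<longleftrightarrow> L = L\<inverse>"

definition full_placement :: "(nat \<times> nat) set \<Rightarrow> (nat \<times> nat) set \<Rightarrow> bool" where
  "full_placement L p \<longleftrightarrow> p \<subseteq> L \<and>
     (\<forall>i \<in> Domain L. \<exists>!j. (i, j) \<in> p) \<and>
     (\<forall>j \<in> Range L. \<exists>!i. (i, j) \<in> p)"

definition symmetric_placement :: "(nat \<times> nat) set \<Rightarrow> bool" where
  "symmetric_placement p \<longleftrightarrow> p = p\<inverse>"

definition placement_perm :: "(nat \<times> nat) set \<Rightarrow> nat \<Rightarrow> nat" where
  "placement_perm p i = (if i \<in> Domain p then THE j. (i, j) \<in> p else i)"

definition order_isomorphic :: "nat list \<Rightarrow> nat list \<Rightarrow> bool" where
  "order_isomorphic xs ys \<longleftrightarrow> length xs = length ys \<and>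
     (\<forall>r < length xs. \<forall>s < length xs. xs ! r < xs ! s \<longleftrightarrow> ys ! r < ys ! s)"

text \<open>Patterns are nonempty lists in one-line notation; the list \<open>is\<close> below is the sequence of
  columns \<open>i\<^sub>1 < \<dots> < i\<^sub>m\<close>. The last conjunct says that the selected dots lie in a
  rectangular sub-board of \<open>L\<close>.\<close>

definition contains_pattern :: "(nat \<times> nat) set \<Rightarrow> (nat \<times> nat) set \<Rightarrow> nat list \<Rightarrow> bool" where
  "contains_pattern L p \<tau> \<longleftrightarrow>
     (\<exists>is. sorted_wrt (<) is \<and> set is \<subseteq> Domain L \<and>
        order_isomorphic (map (placement_perm p) is) \<tau> \<and>
        (last is, Max (set (map (placement_perm p) is))) \<in> L)"

abbreviation avoids_pattern :: "(nat \<times> nat) set \<Rightarrow> (nat \<times> nat) set \<Rightarrow> nat list \<Rightarrow> bool" where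
  "avoids_pattern L p \<tau> \<equiv> \<not> contains_pattern L p \<tau>"

definition symmetric_avoiders :: "(nat \<times> nat) set \<Rightarrow> nat list \<Rightarrow> (nat \<times> nat) set set" where
  "symmetric_avoiders L \<tau> =
     {p. full_placement L p \<and> symmetric_placement p \<and> avoids_pattern L p \<tau>}"

text \<open>The patterns \<open>k\<cdots>21\<close> and \<open>(k-1)\<cdots>21k\<close>.\<close>

definition decreasing_pattern :: "nat \<Rightarrow> nat list" where
  "decreasing_pattern k = rev [1..<k + 1]"

definition decreasing_then_max_pattern :: "nat \<Rightarrow> nat list" where
  "decreasing_then_max_pattern k = rev [1..<k] @ [k]"

lemma ferrers_board_Domain:
  assumes "ferrers_board L"
  shows "Domain L = {1..card (Domain L)}"
proof (cases "L = {}")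
  case False
  have fin: "finite (Domain L)"
    using assms by (simp add: ferrers_board_def finite_Domain)
  have pos: "1 \<le> i \<and> 1 \<le> j" if "(i, j) \<in> L" for i j
    using assms that unfolding ferrers_board_def by blast
  have down: "(i', j') \<in> L" if "(i, j) \<in> L" "1 \<le> i'" "i' \<le> i" "1 \<le> j'" "j' \<le> j" for i j i' j'
    using assms that unfolding ferrers_board_def by blast
  define n where "n = Max (Domain L)"
  have n: "n \<in> Domain L"
    unfolding n_def using fin False by (intro Max_in) auto
  have "Domain L = {1..n}"
  proof (intro set_eqI iffI)
    fix i assume "i \<in> Domain L"
    then show "i \<in> {1..n}"
      using pos fin unfolding n_def by auto
  next
    fix i assume i: "i \<in> {1..n}"
    obtain j where j: "(n, j) \<in> L" using n by auto
    have "(i, j) \<in> L"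
      using down[OF j, of i j] pos[OF j] i by simp
    then show "i \<in> Domain L" by auto
  qed
  then show ?thesis by simp
qed auto

lemma placement_perm_eq_iff:
  assumes "full_placement L p" and "i \<in> Domain L"
  shows "placement_perm p i = j \<longleftrightarrow> (i, j) \<in> p"
proof -
  have ex1: "\<exists>!j. (i, j) \<in> p"
    using assms unfolding full_placement_def by blast
  then have "i \<in> Domain p" by blast
  then have "placement_perm p i = (THE j. (i, j) \<in> p)"
    by (simp add: placement_perm_def)
  moreover have "(i, THE j. (i, j) \<in> p) \<in> p" using ex1 by (rule theI')
  ultimately show ?thesis using ex1 by auto
qed

lemma placement_perm_permutes:
  assumes "full_placement L p" and "Domain L = Range L"
  shows "placement_perm p permutes Domain L"
proof (rule bij_imp_permutes)
  note eq = placement_perm_eq_iff[OF assms(1)]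
  have sub: "p \<subseteq> L" and row: "\<forall>j \<in> Range L. \<exists>!i. (i, j) \<in> p"
    using assms(1) by (simp_all add: full_placement_def)
  show "bij_betw (placement_perm p) (Domain L) (Domain L)"
  proof (rule bij_betw_imageI)
    show "inj_on (placement_perm p) (Domain L)"
    proof (rule inj_onI)
      fix x y assume x: "x \<in> Domain L" and y: "y \<in> Domain L"
        and same: "placement_perm p x = placement_perm p y"
      have xy: "(x, placement_perm p x) \<in> p" "(y, placement_perm p x) \<in> p"
        using eq[OF x, of "placement_perm p x"] eq[OF y, of "placement_perm p y"] same by simp_all
      have "placement_perm p x \<in> Range L"
        using sub xy(1) by blast
      then have "\<exists>!i. (i, placement_perm p x) \<in> p" using row by blast
      then show "x = y" using xy by blast
    qed
    show "placement_perm p ` Domain L = Domain L"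
    proof (intro set_eqI iffI)
      fix j assume "j \<in> placement_perm p ` Domain L"
      then obtain i where "i \<in> Domain L" "placement_perm p i = j" by blast
      then have "(i, j) \<in> p" using eq by simp
      then show "j \<in> Domain L" using sub assms(2) by blast
    next
      fix j assume "j \<in> Domain L"
      then have "\<exists>!i. (i, j) \<in> p" using row assms(2) by simp
      then obtain i where i: "(i, j) \<in> p" by blast
      then have iL: "i \<in> Domain L" using sub by blast
      then have "placement_perm p i = j" using eq i by simp
      then show "j \<in> placement_perm p ` Domain L" using iL by blast
    qed
  qed
  fix i assume "i \<notin> Domain L"
  then have "i \<notin> Domain p" using sub by blast
  then show "placement_perm p i = i" by (simp add: placement_perm_def)
qed

end

(* The proof uses Fomin's growth diagrams, following Krattenthaler. Label each corner (x, y) of a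
   board by the RSK shape of the dots in [1..x] x [1..y]. The labels along the outer boundary
   determine a (partial) rook placement, and the admissible boundary labellings are exactly the
   sequences of partitions in which neighbours differ by at most one box. Conjugating all boundary
   labels is therefore an involution on placements; it exchanges the avoidance of k...21 and of
   12...k, since the first part and the number of parts of a label are the maximal lengths of an
   increasing and of a decreasing chain. It preserves the occupied rows and columns and commutes
   with inversion, hence acts on symmetric full placements.
   Now 12...k is 12...(k-1) followed by a maximum, and a pattern followed by a maximum occurs in a
   placement iff the pattern occurs in the sub-board of cells lying strictly below and to the left
   of some dot. Applying the involution for k-1 inside that sub-board exchanges 12...k with
   (k-1)...21k, and composing the two involutions gives the theorem. *)

theory Submission
  imports Defs
begin

section \<open>Increasing chains and the skeleton of a placement\<close>

text \<open>A bijection between all placements need not restrict to symmetric ones. Growth labels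
  respect symmetry because the local rule treats its two neighbours alike, so inverting a placement
  merely reflects its labels. The shapes come from Viennot's geometric construction rather than from
  insertion: the skeleton of a placement is again a placement, first parts are increasing chain
  lengths by construction, and each passage to the skeleton shortens the longest nonempty decreasing
  chain by exactly one. The second involution looks circular, since the sub-board on which it acts
  is cut out by the very placement being altered. The circle is broken by the dots outside the
  sub-board: they stay fixed and already generate all of it, while the new dots inside cannot
  enlarge it. Hence the sub-board survives and the map can be undone.\<close>

fun longest_incr :: "(nat \<times> nat) set \<Rightarrow> nat \<Rightarrow> nat \<Rightarrow> nat" where
  "longest_incr c 0 y = 0"
| "longest_incr c (Suc x) 0 = 0"
| "longest_incr c (Suc x) (Suc y) =
     max (longest_incr c x (Suc y)) (longest_incr c (Suc x) y) + of_bool ((Suc x, Suc y) \<in> c)"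

definition rook :: "(nat \<times> nat) set \<Rightarrow> bool" where
  "rook c \<longleftrightarrow> single_valued c \<and> single_valued (c\<inverse>)"

text \<open>Cells where two branches of equally long increasing chains meet: the inner corners of
  Viennot's shadow lines, i.e. the cells at which RSK bumps out of the first row.\<close>

definition skeleton :: "(nat \<times> nat) set \<Rightarrow> (nat \<times> nat) set" where
  "skeleton c = {(Suc x, Suc y) | x y. longest_incr c x y < longest_incr c (Suc x) y \<and>
    longest_incr c x y < longest_incr c x (Suc y)}"

lemma rook_converse [simp]: "rook (c\<inverse>) \<longleftrightarrow> rook c"
  by (auto simp: rook_def)

lemma rook_colD: "rook c \<Longrightarrow> (i, j) \<in> c \<Longrightarrow> (i, j') \<in> c \<Longrightarrow> j = j'"
  by (auto simp: rook_def single_valued_def)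

lemma rook_rowD: "rook c \<Longrightarrow> (i, j) \<in> c \<Longrightarrow> (i', j) \<in> c \<Longrightarrow> i = i'"
  by (auto simp: rook_def single_valued_def)

lemma rook_subset: "rook c \<Longrightarrow> d \<subseteq> c \<Longrightarrow> rook d"
  unfolding rook_def single_valued_def by blast

lemma longest_incr_0_right [simp]: "longest_incr c x 0 = 0"
  by (cases x) auto

lemma longest_incr_converse: "longest_incr (c\<inverse>) y x = longest_incr c x y"
proof (induction c x y rule: longest_incr.induct)
  case (3 c x y)
  then show ?case by (simp add: max.commute)
qed auto

lemma skeleton_converse: "skeleton (c\<inverse>) = (skeleton c)\<inverse>"
  by (auto simp: skeleton_def longest_incr_converse)

lemma longest_incr_Suc_left: "longest_incr c x y \<le> longest_incr c (Suc x) y"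
  by (cases y) auto

lemma longest_incr_Suc_right: "longest_incr c x y \<le> longest_incr c x (Suc y)"
  by (cases x) auto

lemma longest_incr_mono: "x \<le> x' \<Longrightarrow> y \<le> y' \<Longrightarrow> longest_incr c x y \<le> longest_incr c x' y'"
proof -
  assume "x \<le> x'" "y \<le> y'"
  have "longest_incr c x y \<le> longest_incr c x' y"
    by (rule lift_Suc_mono_le[of "\<lambda>x. longest_incr c x y"]) (simp_all add: longest_incr_Suc_left \<open>x \<le> x'\<close>)
  also have "\<dots> \<le> longest_incr c x' y'"
    by (rule lift_Suc_mono_le[of "longest_incr c x'"]) (simp_all add: longest_incr_Suc_right \<open>y \<le> y'\<close>)
  finally show ?thesis .
qed

lemma longest_incr_cong:
  assumes "\<And>i j. i \<le> x \<Longrightarrow> j \<le> y \<Longrightarrow> (i, j) \<in> c \<longleftrightarrow> (i, j) \<in> d"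
  shows "longest_incr c x y = longest_incr d x y"
  using assms by (induction c x y rule: longest_incr.induct) auto

text \<open>Going down from height \<open>y\<close>, a jump across the column persists through every
  cell without a dot: there the larger value comes from below, while the left value cannot grow.
  Only a dot of the column can have created it, so the jump is a vertical piece of a shadow line
  starting at that dot.\<close>

lemma longest_incr_column_edge:
  assumes "longest_incr c x y < longest_incr c (Suc x) y"
  obtains b where "b \<le> y" "(Suc x, b) \<in> c" "longest_incr c (Suc x) b = longest_incr c (Suc x) y"
    "\<And>j. b \<le> j \<Longrightarrow> j \<le> y \<Longrightarrow> longest_incr c x j < longest_incr c (Suc x) j"
proof -
  have "\<exists>b\<le>y. (Suc x, b) \<in> c \<and> longest_incr c (Suc x) b = longest_incr c (Suc x) y \<and>
    (\<forall>j. b \<le> j \<and> j \<le> y \<longrightarrow> longest_incr c x j < longest_incr c (Suc x) j)"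
    using assms
  proof (induction y)
    case (Suc y)
    show ?case
    proof (cases "(Suc x, Suc y) \<in> c")
      case True
      then show ?thesis using Suc.prems by (metis le_antisym order_refl)
    next
      case False
      then have eq: "longest_incr c (Suc x) (Suc y) = longest_incr c (Suc x) y"
        using Suc.prems by (auto simp: max_def split: if_splits)
      then have "longest_incr c x y < longest_incr c (Suc x) y"
        using Suc.prems longest_incr_Suc_right[of c x y] by linarith
      then show ?thesis using Suc eq by (metis le_Suc_eq)
    qed
  qed auto
  then show thesis using that by blast
qed

lemma longest_incr_row_edge:
  assumes "longest_incr c x y < longest_incr c x (Suc y)"
  obtains a where "a \<le> x" "(a, Suc y) \<in> c" "longest_incr c a (Suc y) = longest_incr c x (Suc y)"
    "\<And>i. a \<le> i \<Longrightarrow> i \<le> x \<Longrightarrow> longest_incr c i y < longest_incr c i (Suc y)"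
  using longest_incr_column_edge[of "c\<inverse>" y x] assms that by (auto simp: longest_incr_converse)

lemma longest_incr_dot_left:
  assumes "rook c" "(Suc x, Suc y) \<in> c"
  shows "longest_incr c (Suc x) y = longest_incr c x y"
proof (rule ccontr)
  assume "\<not> ?thesis"
  then have "longest_incr c x y < longest_incr c (Suc x) y"
    using longest_incr_Suc_left[of c x y] by linarith
  then obtain b where "b \<le> y" "(Suc x, b) \<in> c" by (rule longest_incr_column_edge)
  then show False using rook_colD[OF assms(1) assms(2)] by fastforce
qed

lemma longest_incr_dot_right:
  assumes "rook c" "(Suc x, Suc y) \<in> c"
  shows "longest_incr c x (Suc y) = longest_incr c x y"
  using longest_incr_dot_left[of "c\<inverse>" y x] assms by (simp add: longest_incr_converse)

lemma longest_incr_column_add_box: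
  assumes "rook c"
  shows "longest_incr c (Suc x) y \<le> Suc (longest_incr c x y)"
proof (induction y)
  case (Suc y)
  then show ?case
    using longest_incr_Suc_right[of c x y] longest_incr_dot_left[OF assms, of x y]
    by (cases "(Suc x, Suc y) \<in> c") auto
qed auto

lemma longest_incr_row_add_box: "rook c \<Longrightarrow> longest_incr c x (Suc y) \<le> Suc (longest_incr c x y)"
  using longest_incr_column_add_box[of "c\<inverse>" y x] by (simp add: longest_incr_converse)

lemma skeleton_dot_iff:
  "(Suc x, Suc y) \<in> skeleton c \<longleftrightarrow>
    longest_incr c x y < longest_incr c (Suc x) y \<and> longest_incr c x y < longest_incr c x (Suc y)"
  by (auto simp: skeleton_def)

lemma skelE:
  assumes "p \<in> skeleton c"
  obtains x y where "p = (Suc x, Suc y)"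
    "longest_incr c x y < longest_incr c (Suc x) y" "longest_incr c x y < longest_incr c x (Suc y)"
  using assms by (auto simp: skeleton_def)

lemma skeleton_disjoint: "rook c \<Longrightarrow> (Suc x, Suc y) \<in> skeleton c \<Longrightarrow> (Suc x, Suc y) \<notin> c"
  using longest_incr_dot_left by (fastforce simp: skeleton_dot_iff)

lemma skeleton_flat:
  assumes "rook c" "(Suc x, Suc y) \<in> skeleton c"
  shows "longest_incr c (Suc x) (Suc y) = longest_incr c x (Suc y)"
  using assms skeleton_disjoint[OF assms] longest_incr_column_add_box[OF assms(1), of x y]
    longest_incr_row_add_box[OF assms(1), of x y] by (auto simp: skeleton_dot_iff)

text \<open>Two skeleton cells of a column sit on the edge that starts at its only dot. This edge is
  unbroken up to the higher cell, yet by \<open>skeleton_flat\<close> it ends at the lower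
  one.\<close>

lemma single_valued_skeleton:
  assumes "rook c"
  shows "single_valued (skeleton c)"
proof -
  have False if 1: "(Suc x, Suc y) \<in> skeleton c" and 2: "(Suc x, Suc y') \<in> skeleton c" and "y < y'" for x y y'
  proof -
    have e: "longest_incr c x y' < longest_incr c (Suc x) y'" "longest_incr c x y < longest_incr c (Suc x) y"
      using 1 2 by (auto simp: skeleton_dot_iff)
    obtain b where b: "b \<le> y" "(Suc x, b) \<in> c" using e(2) by (rule longest_incr_column_edge)
    obtain b' where b': "b' \<le> y'" "(Suc x, b') \<in> c"
      "\<And>j. b' \<le> j \<Longrightarrow> j \<le> y' \<Longrightarrow> longest_incr c x j < longest_incr c (Suc x) j"
      using longest_incr_column_edge[OF e(1)] by metis
    have "b = b'" using rook_colD[OF assms b(2) b'(2)] .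
    then have "longest_incr c x (Suc y) < longest_incr c (Suc x) (Suc y)"
      using b \<open>y < y'\<close> by (intro b'(3)) auto
    then show False using skeleton_flat[OF assms 1] by simp
  qed
  then show ?thesis
    unfolding single_valued_def by (metis linorder_neqE_nat skelE prod.inject)
qed

lemma rook_skeleton: "rook c \<Longrightarrow> rook (skeleton c)"
  using single_valued_skeleton[of c] single_valued_skeleton[of "c\<inverse>"]
  by (simp add: rook_def skeleton_converse)

text \<open>Both increments are 0 or 1, so their minimum is the conjunction that defines the
  skeleton. In this shape the dots of the next skeleton turn into the bumping term of
  \<open>forward_rule\<close>.\<close>

lemma skeleton_of_bool:
  assumes "rook c"
  shows "of_bool ((Suc x, Suc y) \<in> skeleton c) =
    min (longest_incr c x (Suc y)) (longest_incr c (Suc x) y) - longest_incr c x y"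
  using longest_incr_column_add_box[OF assms, of x y] longest_incr_row_add_box[OF assms, of x y]
    longest_incr_Suc_left[of c x y] longest_incr_Suc_right[of c x y]
  by (auto simp: skeleton_dot_iff)

section \<open>Decreasing chains\<close>

text \<open>Indexing by functions lets chains of a placement and of its skeleton be interleaved
  index by index. Length 0 is attained everywhere, hence the later assumptions
  \<open>0 < m\<close>.\<close>

definition dec_chain :: "(nat \<times> nat) set \<Rightarrow> nat \<Rightarrow> nat \<Rightarrow> nat \<Rightarrow> bool" where
  "dec_chain c m x y \<longleftrightarrow> (\<exists>f g. (\<forall>i<m. (f i, g i) \<in> c \<and> f i \<le> x \<and> g i \<le> y) \<and>
     (\<forall>i. Suc i < m \<longrightarrow> f i < f (Suc i) \<and> g (Suc i) < g i))"

text \<open>The first cell has a dot below it in column \<open>i\<close>, the second one a dot to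
  its left in row \<open>j'\<close>. At least one of these two dots falls into the
  rectangle.\<close>

lemma dot_between_skeleton:
  assumes "rook c" and s: "(i, j) \<in> skeleton c" "(i', j') \<in> skeleton c" and "i < i'" "j' < j"
  shows "\<exists>a b. (a, b) \<in> c \<and> i \<le> a \<and> a < i' \<and> j' \<le> b \<and> b < j"
proof -
  obtain x y where ij: "i = Suc x" "j = Suc y"
    and e1: "longest_incr c x y < longest_incr c (Suc x) y" using s(1) by (auto elim: skelE)
  obtain x' y' where ij': "i' = Suc x'" "j' = Suc y'"
    and e2: "longest_incr c x' y' < longest_incr c x' (Suc y')" using s(2) by (auto elim: skelE)
  obtain b where b: "b \<le> y" "(i, b) \<in> c" "longest_incr c i b = longest_incr c (Suc x) y"
    using longest_incr_column_edge[OF e1] ij by metis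
  obtain a where a: "a \<le> x'" "(a, j') \<in> c" "longest_incr c a j' = longest_incr c x' (Suc y')"
    using longest_incr_row_edge[OF e2] ij' by metis
  consider "j' \<le> b" | "i \<le> a" | "b < j'" "a < i" by linarith
  then show ?thesis
  proof cases
    case 1
    then show ?thesis using b ij \<open>i < i'\<close> by (intro exI[of _ i] exI[of _ b]) auto
  next
    case 2
    then show ?thesis using a ij' \<open>j' < j\<close> by (intro exI[of _ a] exI[of _ j']) auto
  next
    case 3
    \<comment> \<open>If both dots miss the rectangle, each lies in the region measured at the other
      skeleton cell, and the chain lengths form a strict cycle.\<close>
    have "longest_incr c i b \<le> longest_incr c x' y'" "longest_incr c a j' \<le> longest_incr c x y"
      using 3 assms(4,5) ij ij' by (auto intro!: longest_incr_mono)
    then show ?thesis using e1 e2 a(3) b(3) by linarith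
  qed
qed

text \<open>A shadow line edge can stop only at a skeleton cell. Without one in the rectangle, the
  vertical edge rising from the lower dot and the horizontal edge running right from the upper dot
  both reach the corner \<open>(i', j)\<close>.\<close>

lemma skeleton_between_dots:
  assumes "rook c" and d: "(i, j) \<in> c" "(i', j') \<in> c" and lt: "i < i'" "j' < j" and pos: "0 < i" "0 < j'"
  shows "\<exists>a b. (a, b) \<in> skeleton c \<and> i < a \<and> a \<le> i' \<and> j' < b \<and> b \<le> j"
proof (rule ccontr)
  assume none: "\<not> ?thesis"
  obtain x' where x': "i' = Suc x'" "i \<le> x'" using lt by (cases i') auto
  obtain y where y: "j = Suc y" "j' \<le> y" using lt by (cases j) auto
  obtain y' where y': "j' = Suc y'" using pos by (cases j') auto
  have "longest_incr c x' b < longest_incr c (Suc x') b" if "j' \<le> b" "b \<le> j" for b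
    using that
  proof (induction b rule: dec_induct)
    case base
    then show ?case using longest_incr_dot_right[OF assms(1), of x' y'] d(2) x' y'
      longest_incr_Suc_left[of c x' "y'"]  by simp
  next
    case (step b)
    have "\<not> ((Suc x', Suc b) \<in> skeleton c \<and> i < Suc x' \<and> Suc x' \<le> i' \<and> j' < Suc b \<and> Suc b \<le> j)"
      using none by blast
    then have "(Suc x', Suc b) \<notin> skeleton c" "longest_incr c x' b < longest_incr c (Suc x') b"
      using step x' by auto
    then have "longest_incr c x' (Suc b) = longest_incr c x' b"
      using longest_incr_Suc_right[of c x' b] by (auto simp: skeleton_dot_iff)
    then show ?case using \<open>longest_incr c x' b < longest_incr c (Suc x') b\<close> by simp
  qed
  then have 1: "longest_incr c x' j < longest_incr c i' j" using x' lt by simp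
  have "longest_incr c a y < longest_incr c a (Suc y)" if "i \<le> a" "a \<le> i'" for a
    using that
  proof (induction a rule: dec_induct)
    case base
    show ?case
    proof -
      obtain x where "i = Suc x" using pos by (cases i) auto
      then show ?thesis using longest_incr_dot_left[OF assms(1), of x y] d(1) y
        longest_incr_Suc_right[of c x y] by simp
    qed
  next
    case (step a)
    have "\<not> ((Suc a, Suc y) \<in> skeleton c \<and> i < Suc a \<and> Suc a \<le> i' \<and> j' < Suc y \<and> Suc y \<le> j)"
      using none by blast
    then have "(Suc a, Suc y) \<notin> skeleton c" "longest_incr c a y < longest_incr c a (Suc y)"
      using step y by auto
    then have "longest_incr c (Suc a) y = longest_incr c a y"
      using longest_incr_Suc_left[of c a y] by (auto simp: skeleton_dot_iff)
    then show ?case using \<open>longest_incr c a y < longest_incr c a (Suc y)\<close> by simp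
  qed
  then have 2: "longest_incr c i' y < longest_incr c i' j" using lt y by simp
  \<comment> \<open>A value above both the left and the lower one forces a dot, but column
    \<open>i'\<close> already has its dot at height \<open>j'\<close>.\<close>
  have "(i', j) \<notin> c" using rook_colD[OF assms(1) d(2)] lt by fastforce
  then show False using 1 2 x' y by simp
qed

text \<open>A skeleton cell supplies a dot to its left and one below it, and two consecutive skeleton cells
  of a decreasing chain have a dot between them: this gains one dot.\<close>

lemma dec_chain_skeleton_imp:
  assumes "rook c" "0 < m" "dec_chain (skeleton c) m x y"
  shows "dec_chain c (Suc m) x y"
proof -
  obtain f g where fg: "\<And>i. i < m \<Longrightarrow> (f i, g i) \<in> skeleton c" "\<And>i. i < m \<Longrightarrow> f i \<le> x"
    "\<And>i. i < m \<Longrightarrow> g i \<le> y" "\<And>i. Suc i < m \<Longrightarrow> f i < f (Suc i)"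
    "\<And>i. Suc i < m \<Longrightarrow> g (Suc i) < g i"
    using assms(3) unfolding dec_chain_def by blast
  have "\<exists>a b. (a, b) \<in> c \<and> a \<le> x \<and> b \<le> y \<and>
      (i < m \<longrightarrow> a < f i \<and> g i \<le> b) \<and> (0 < i \<longrightarrow> f (i - 1) \<le> a \<and> b < g (i - 1))"
    if im: "i \<le> m" for i
  proof -
    consider "i = 0" | "i = m" "i \<noteq> 0" | j where "i = Suc j" "Suc j < m"
      using im by (cases i) (auto simp: le_less)
    then show ?thesis
    proof cases
      case 1
      obtain u v where uv: "f 0 = Suc u" "g 0 = Suc v" and "longest_incr c u v < longest_incr c u (Suc v)"
        using fg(1)[OF assms(2)] by (auto elim: skelE)
      then obtain a where "a \<le> u" "(a, Suc v) \<in> c" by (auto elim: longest_incr_row_edge)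
      then show ?thesis using 1 uv fg(2,3)[OF assms(2)]
        by (intro exI[of _ a] exI[of _ "Suc v"]) auto
    next
      case 2
      then have lt: "m - 1 < m" by simp
      obtain u v where uv: "f (m - 1) = Suc u" "g (m - 1) = Suc v" and "longest_incr c u v < longest_incr c (Suc u) v"
        using fg(1)[OF lt] by (auto elim: skelE)
      then obtain b where "b \<le> v" "(Suc u, b) \<in> c" by (auto elim: longest_incr_column_edge)
      then show ?thesis using 2 uv fg(2,3)[OF lt] by (intro exI[of _ "Suc u"] exI[of _ b]) auto
    next
      case 3
      have "\<exists>a b. (a, b) \<in> c \<and> f j \<le> a \<and> a < f (Suc j) \<and> g (Suc j) \<le> b \<and> b < g j"
        using 3 by (intro dot_between_skeleton[OF assms(1)] fg) auto
      then show ?thesis using 3 fg(2)[of i] fg(3)[of j] by fastforce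
    qed
  qed
  then obtain F G where FG: "\<And>i. i \<le> m \<Longrightarrow> (F i, G i) \<in> c \<and> F i \<le> x \<and> G i \<le> y \<and>
      (i < m \<longrightarrow> F i < f i \<and> g i \<le> G i) \<and> (0 < i \<longrightarrow> f (i - 1) \<le> F i \<and> G i < g (i - 1))"
    by metis
  have "F i < F (Suc i) \<and> G (Suc i) < G i" if "i < m" for i
    using FG[of i] FG[of "Suc i"] that by auto
  then show ?thesis
    unfolding dec_chain_def using FG by (intro exI[of _ F] exI[of _ G]) auto
qed

lemma dec_chain_imp_skeleton:
  assumes "rook c" "\<And>i j. (i, j) \<in> c \<Longrightarrow> 0 < i \<and> 0 < j" "dec_chain c (Suc m) x y"
  shows "dec_chain (skeleton c) m x y"
proof -
  obtain f g where fg0: "\<forall>i<Suc m. (f i, g i) \<in> c \<and> f i \<le> x \<and> g i \<le> y"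
    "\<forall>i. Suc i < Suc m \<longrightarrow> f i < f (Suc i) \<and> g (Suc i) < g i"
    using assms(3) unfolding dec_chain_def by blast
  have fg: "(f i, g i) \<in> c" "f i \<le> x" "g i \<le> y" if "i \<le> m" for i
    using fg0(1) that by auto
  have fg': "f i < f (Suc i)" "g (Suc i) < g i" if "i < m" for i
    using fg0(2) that by auto
  have "\<exists>a b. (a, b) \<in> skeleton c \<and> f i < a \<and> a \<le> f (Suc i) \<and> g (Suc i) < b \<and> b \<le> g i"
    if "i < m" for i
    using that assms(2)[of "f i" "g i"] assms(2)[of "f (Suc i)" "g (Suc i)"]
      fg(1)[of i] fg(1)[of "Suc i"] fg'[of i]
    by (intro skeleton_between_dots[OF assms(1)]) auto
  then obtain F G where FG: "\<And>i. i < m \<Longrightarrow> (F i, G i) \<in> skeleton c \<and> f i < F i \<and>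
      F i \<le> f (Suc i) \<and> g (Suc i) < G i \<and> G i \<le> g i"
    by metis
  have "F i < F (Suc i) \<and> G (Suc i) < G i" if "Suc i < m" for i
    using FG[of i] FG[of "Suc i"] that by auto
  moreover have "F i \<le> x \<and> G i \<le> y" if "i < m" for i
    using FG[OF that] fg(2)[of "Suc i"] fg(3)[of i] that by auto
  ultimately show ?thesis
    unfolding dec_chain_def using FG by (intro exI[of _ F] exI[of _ G]) auto
qed

lemma rook_funpow_skeleton: "rook c \<Longrightarrow> rook ((skeleton ^^ r) c)"
  by (induction r) (auto intro: rook_skeleton)

lemma skeleton_pos: "(i, j) \<in> skeleton c \<Longrightarrow> 0 < i \<and> 0 < j"
  by (auto elim: skelE)

lemma dec_chain_funpow_skeleton:
  assumes "rook c" "\<And>i j. (i, j) \<in> c \<Longrightarrow> 0 < i \<and> 0 < j"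
  shows "dec_chain c (Suc (r + m)) x y \<longleftrightarrow> dec_chain ((skeleton ^^ r) c) (Suc m) x y"
  using assms
proof (induction r arbitrary: c)
  case (Suc r)
  have "dec_chain c (Suc (Suc (r + m))) x y \<longleftrightarrow> dec_chain (skeleton c) (Suc (r + m)) x y"
    using Suc.prems dec_chain_skeleton_imp[of c "Suc (r + m)" x y] dec_chain_imp_skeleton[of c "Suc (r + m)" x y]
    by blast
  also have "\<dots> \<longleftrightarrow> dec_chain ((skeleton ^^ r) (skeleton c)) (Suc m) x y"
    using Suc.prems skeleton_pos by (intro Suc.IH rook_skeleton) blast+
  finally show ?case by (simp add: funpow_Suc_right del: funpow.simps)
qed auto

text \<open>Cells on the axes are invisible to \<open>longest_incr\<close> but would count in
  \<open>dec_chain\<close>; positivity reconciles the two.\<close>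

lemma longest_incr_pos_iff:
  assumes "\<And>i j. (i, j) \<in> c \<Longrightarrow> 0 < i \<and> 0 < j"
  shows "0 < longest_incr c x y \<longleftrightarrow> dec_chain c 1 x y"
proof -
  have "0 < longest_incr c x y \<longleftrightarrow> (\<exists>i j. (i, j) \<in> c \<and> i \<le> x \<and> j \<le> y)"
    using assms by (induction c x y rule: longest_incr.induct) (fastforce simp: le_Suc_eq)+
  then show ?thesis by (auto simp: dec_chain_def)
qed

section \<open>Growth labels and local rules\<close>

text \<open>Iterating the skeleton yields the RSK shape: part \<open>r\<close> (counted from 0) of the label is the
  longest increasing chain in the \<open>r\<close>-th iterated skeleton.\<close>

definition growth :: "(nat \<times> nat) set \<Rightarrow> nat \<Rightarrow> nat \<Rightarrow> nat \<Rightarrow> nat" where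
  "growth c x y r = longest_incr ((skeleton ^^ r) c) x y"

text \<open>After \<open>r\<close> skeletons a decreasing chain of length \<open>Suc r\<close> has
  shrunk to a single dot. This is the half of Schensted's theorem that reads decreasing chains off
  the number of parts.\<close>

lemma growth_pos_iff:
  assumes "rook c" "\<And>i j. (i, j) \<in> c \<Longrightarrow> 0 < i \<and> 0 < j"
  shows "0 < growth c x y r \<longleftrightarrow> dec_chain c (Suc r) x y"
proof -
  have "0 < growth c x y r \<longleftrightarrow> dec_chain ((skeleton ^^ r) c) 1 x y"
    unfolding growth_def using assms(2) skeleton_pos by (intro longest_incr_pos_iff) (cases r; auto)
  then show ?thesis using dec_chain_funpow_skeleton[OF assms, of r 0] by simp
qed

text \<open>Fomin's local rule in its piecewise linear form; \<open>d\<close> is 1 if the cell carries a dot.\<close>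

definition forward_rule :: "nat \<Rightarrow> (nat \<Rightarrow> nat) \<Rightarrow> (nat \<Rightarrow> nat) \<Rightarrow> (nat \<Rightarrow> nat) \<Rightarrow> nat \<Rightarrow> nat" where
  "forward_rule d \<rho> \<mu> \<nu> r = max (\<mu> r) (\<nu> r) + (case r of 0 \<Rightarrow> d | Suc s \<Rightarrow> min (\<mu> s) (\<nu> s) - \<rho> s)"

lemma growth_0_left [simp]: "growth c 0 y = (\<lambda>_. 0)"
  and growth_0_right [simp]: "growth c x 0 = (\<lambda>_. 0)"
  by (auto simp: growth_def)

text \<open>Part 0 is the recursion of \<open>longest_incr\<close>. In a later part the dot
  indicator belongs to a skeleton, and \<open>skeleton_of_bool\<close> rewrites it through the
  preceding part of the neighbouring labels, so that only dots of \<open>c\<close> itself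
  enter.\<close>

lemma growth_Suc_Suc:
  assumes "rook c"
  shows "growth c (Suc x) (Suc y) =
    forward_rule (of_bool ((Suc x, Suc y) \<in> c)) (growth c x y) (growth c (Suc x) y) (growth c x (Suc y))"
proof
  fix r
  show "growth c (Suc x) (Suc y) r =
    forward_rule (of_bool ((Suc x, Suc y) \<in> c)) (growth c x y) (growth c (Suc x) y) (growth c x (Suc y)) r"
  proof (cases r)
    case (Suc s)
    show ?thesis
      using skeleton_of_bool[OF rook_funpow_skeleton[OF assms], of x y s] Suc
      by (simp add: growth_def forward_rule_def max.commute min.commute)
  qed (simp add: growth_def forward_rule_def max.commute)
qed

lemma funpow_skeleton_converse: "(skeleton ^^ r) (c\<inverse>) = ((skeleton ^^ r) c)\<inverse>"
  by (induction r) (auto simp: skeleton_converse)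

lemma growth_converse: "growth (c\<inverse>) y x = growth c x y"
  by (auto simp: growth_def funpow_skeleton_converse longest_incr_converse)

lemma skeleton_cong:
  assumes "\<And>i j. i \<le> x \<Longrightarrow> j \<le> y \<Longrightarrow> (i, j) \<in> c \<longleftrightarrow> (i, j) \<in> d" "i \<le> x" "j \<le> y"
  shows "(i, j) \<in> skeleton c \<longleftrightarrow> (i, j) \<in> skeleton d"
proof (cases i; cases j)
  fix u v assume "i = Suc u" "j = Suc v"
  moreover have "longest_incr c a b = longest_incr d a b" if "a \<le> x" "b \<le> y" for a b
    using assms(1) that by (intro longest_incr_cong) auto
  ultimately show ?thesis using assms by (simp add: skeleton_dot_iff)
qed (auto dest: skeleton_pos)

lemma growth_cong:
  assumes "\<And>i j. i \<le> x \<Longrightarrow> j \<le> y \<Longrightarrow> (i, j) \<in> c \<longleftrightarrow> (i, j) \<in> d"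
  shows "growth c x y = growth d x y"
proof
  fix r
  have "\<forall>i\<le>x. \<forall>j\<le>y. (i, j) \<in> (skeleton ^^ r) c \<longleftrightarrow> (i, j) \<in> (skeleton ^^ r) d"
  proof (induction r)
    case (Suc r)
    then show ?case using skeleton_cong[of x y "(skeleton ^^ r) c" "(skeleton ^^ r) d"] by simp
  qed (use assms in auto)
  then show "growth c x y r = growth d x y r" unfolding growth_def by (intro longest_incr_cong) auto
qed

text \<open>By monotonicity a single zero makes all later parts vanish, so the sets counted by
  \<open>conjugate\<close> are finite.\<close>

definition partition :: "(nat \<Rightarrow> nat) \<Rightarrow> bool" where
  "partition \<rho> \<longleftrightarrow> antimono \<rho> \<and> (\<exists>N. \<rho> N = 0)"

text \<open>Equality is included because a row or column may be empty up to the corner in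
  question.\<close>

definition add_box :: "(nat \<Rightarrow> nat) \<Rightarrow> (nat \<Rightarrow> nat) \<Rightarrow> bool" where
  "add_box \<rho> \<mu> \<longleftrightarrow> \<mu> = \<rho> \<or> (\<exists>s. \<mu> = \<rho>(s := Suc (\<rho> s)))"

lemma stepE:
  assumes "add_box \<rho> \<mu>"
  obtains "\<mu> = \<rho>" | s where "\<mu> = \<rho>(s := Suc (\<rho> s))"
  using assms by (auto simp: add_box_def)

lemma add_box_refl [simp]: "add_box \<rho> \<rho>"
  by (simp add: add_box_def)

lemma add_box_upd [simp]: "add_box \<rho> (\<rho>(s := Suc (\<rho> s)))"
  by (auto simp: add_box_def)

lemma partition_altdef: "partition \<rho> \<longleftrightarrow> (\<forall>r. \<rho> (Suc r) \<le> \<rho> r) \<and> (\<exists>N. \<rho> N = 0)"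
  unfolding partition_def antimono_iff_le_Suc by blast

lemma partition_zero [simp]: "partition (\<lambda>_. 0)"
  by (auto simp: partition_altdef)

lemma partitionD: "partition \<rho> \<Longrightarrow> r \<le> s \<Longrightarrow> \<rho> s \<le> \<rho> r"
  by (auto simp: partition_def antimono_def)

lemma partition_upd:
  assumes "partition \<rho>" "s = 0 \<or> \<rho> s < \<rho> (s - 1)"
  shows "partition (\<rho>(s := Suc (\<rho> s)))"
proof -
  obtain N where N: "\<rho> N = 0" using assms(1) by (auto simp: partition_def)
  \<comment> \<open>The index lies beyond both \<open>N\<close> and the updated position
    \<open>s\<close>, so the zero survives the update.\<close>
  have "\<rho> (Suc (N + s)) \<le> \<rho> N" by (rule partitionD[OF assms(1)]) simp
  then have "(\<rho>(s := Suc (\<rho> s))) (Suc (N + s)) = 0" using N by simp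
  then have "\<exists>N. (\<rho>(s := Suc (\<rho> s))) N = 0" by blast
  moreover have "(\<rho>(s := Suc (\<rho> s))) (Suc r) \<le> (\<rho>(s := Suc (\<rho> s))) r" for r
    using assms partitionD[OF assms(1), of r "Suc r"] by (auto simp: fun_upd_def)
  ultimately show ?thesis unfolding partition_altdef by blast
qed

section \<open>The cases of Fomin's local rule\<close>

lemma forward_rule_0_left: "(\<And>r. \<rho> r \<le> \<mu> r) \<Longrightarrow> forward_rule 0 \<rho> \<rho> \<mu> = \<mu>"
  by (auto simp: forward_rule_def fun_eq_iff split: nat.split)

lemma forward_rule_commute: "forward_rule d \<rho> \<mu> \<nu> = forward_rule d \<rho> \<nu> \<mu>"
  by (auto simp: forward_rule_def fun_eq_iff max.commute min.commute split: nat.split)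

lemma forward_rule_0_right: "(\<And>r. \<rho> r \<le> \<mu> r) \<Longrightarrow> forward_rule 0 \<rho> \<mu> \<rho> = \<mu>"
  using forward_rule_0_left forward_rule_commute by metis

lemma add_box_le: "add_box \<rho> \<mu> \<Longrightarrow> \<rho> r \<le> \<mu> r"
  by (auto simp: add_box_def)

lemma forward_rule_1: "forward_rule 1 \<rho> \<rho> \<rho> = \<rho>(0 := Suc (\<rho> 0))"
  by (auto simp: forward_rule_def fun_eq_iff split: nat.split)

lemma forward_rule_same: "forward_rule 0 \<rho> (\<rho>(s := Suc (\<rho> s))) (\<rho>(s := Suc (\<rho> s))) =
    (\<rho>(s := Suc (\<rho> s)))(Suc s := Suc (\<rho> (Suc s)))"
  by (auto simp: forward_rule_def fun_eq_iff split: nat.split)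

lemma forward_rule_distinct: "s \<noteq> t \<Longrightarrow> forward_rule 0 \<rho> (\<rho>(s := Suc (\<rho> s))) (\<rho>(t := Suc (\<rho> t))) =
    \<rho>(s := Suc (\<rho> s), t := Suc (\<rho> t))"
  by (auto simp: forward_rule_def fun_eq_iff split: nat.split)

lemma forward_rule_add_box:
  assumes "partition \<rho>" "partition \<mu>" "partition \<nu>" "add_box \<rho> \<mu>" "add_box \<rho> \<nu>"
    and d: "d = 0 \<or> d = 1 \<and> \<mu> = \<rho> \<and> \<nu> = \<rho>"
  shows "partition (forward_rule d \<rho> \<mu> \<nu>) \<and> add_box \<mu> (forward_rule d \<rho> \<mu> \<nu>) \<and> add_box \<nu> (forward_rule d \<rho> \<mu> \<nu>)"
  using d
proof
  assume "d = 1 \<and> \<mu> = \<rho> \<and> \<nu> = \<rho>"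
  then show ?thesis using partition_upd[OF assms(1), of 0] add_box_upd[of \<rho> 0] forward_rule_1[of \<rho>]
    by simp
next
  assume "d = 0"
  show ?thesis
  proof (cases "\<mu> = \<rho> \<or> \<nu> = \<rho>")
    case True
    then show ?thesis
    proof
      assume "\<mu> = \<rho>"
      then show ?thesis using assms forward_rule_0_left[OF add_box_le[OF assms(5)]] \<open>d = 0\<close> by simp
    next
      assume "\<nu> = \<rho>"
      then show ?thesis using assms forward_rule_0_right[OF add_box_le[OF assms(4)]] \<open>d = 0\<close> by simp
    qed
  next
    case False
    then obtain s t where st: "\<mu> = \<rho>(s := Suc (\<rho> s))" "\<nu> = \<rho>(t := Suc (\<rho> t))"
      using assms by (auto simp: add_box_def)
    show ?thesis
    proof (cases "s = t")
      case True
      \<comment> \<open>Bumping is possible because the box just added to row \<open>s\<close> made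
        it strictly longer than the next row.\<close>
      have "\<mu> (Suc s) < \<mu> s" using st(1) partitionD[OF assms(1), of s "Suc s"] by simp
      then have "partition (\<mu>(Suc s := Suc (\<mu> (Suc s))))" by (intro partition_upd[OF assms(2)]) simp
      moreover have "forward_rule d \<rho> \<mu> \<nu> = \<mu>(Suc s := Suc (\<mu> (Suc s)))"
        using forward_rule_same[of \<rho> s] True st \<open>d = 0\<close> by simp
      ultimately show ?thesis using st True add_box_upd[of \<mu> "Suc s"] by simp
    next
      case False
      have eq: "forward_rule d \<rho> \<mu> \<nu> = \<mu>(t := Suc (\<mu> t))" "forward_rule d \<rho> \<mu> \<nu> = \<nu>(s := Suc (\<nu> s))"
        using forward_rule_distinct[of s t \<rho>] False st \<open>d = 0\<close> by (auto simp: fun_upd_twist)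
      \<comment> \<open>Since \<open>\<nu>\<close> is a partition, row \<open>t\<close> of
        \<open>\<rho>\<close> can take a box; enlarging a different row keeps this true.\<close>
      have "t = 0 \<or> \<mu> t < \<mu> (t - 1)"
        using partitionD[OF assms(3), of "t - 1" t] st False by (cases t) (auto split: if_splits)
      then have "partition (forward_rule d \<rho> \<mu> \<nu>)" unfolding eq(1)
        by (intro partition_upd[OF assms(2)])
      then show ?thesis using eq add_box_upd by metis
    qed
  qed
qed

lemma growth_Suc_left_le: "growth c x y r \<le> growth c (Suc x) y r"
  by (simp add: growth_def longest_incr_Suc_left)

lemma growth_Suc_right_le: "growth c x y r \<le> growth c x (Suc y) r"
  by (simp add: growth_def longest_incr_Suc_right)

lemma growth_empty_column:
  assumes "rook c" "\<And>j. j \<le> y \<Longrightarrow> (Suc x, j) \<notin> c"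
  shows "growth c (Suc x) y = growth c x y"
  using assms(2)
proof (induction y)
  case (Suc y)
  then have "growth c (Suc x) y = growth c x y" by simp
  then show ?case
    using Suc.prems[of "Suc y"]
    by (simp add: growth_Suc_Suc[OF assms(1)] forward_rule_0_left growth_Suc_right_le)
qed auto

lemma growth_below_dot:
  assumes "rook c" "(Suc x, Suc y) \<in> c"
  shows "growth c (Suc x) y = growth c x y"
proof (rule growth_empty_column[OF assms(1)])
  show "(Suc x, j) \<notin> c" if "j \<le> y" for j
    using rook_colD[OF assms, of j] that by auto
qed

lemma growth_left_of_dot:
  assumes "rook c" "(Suc x, Suc y) \<in> c"
  shows "growth c x (Suc y) = growth c x y"
  using growth_below_dot[of "c\<inverse>" y x] assms by (simp add: growth_converse)

text \<open>The outer induction carries only the vertical steps along one grid line. The horizontal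
  steps to the next line come from the inner induction on the height, and then yield its vertical
  steps.\<close>

lemma partition_add_box_growth:
assumes "rook c"
shows "\<forall>y. partition (growth c x y) \<and> add_box (growth c x y) (growth c x (Suc y))"
proof (induction x)
  case (Suc x)
  have "partition (growth c (Suc x) y) \<and> add_box (growth c x y) (growth c (Suc x) y)" for y
  proof (induction y)
    case (Suc y)
    then show ?case
      using \<open>\<forall>y. partition (growth c x y) \<and> add_box (growth c x y) (growth c x (Suc y))\<close>
        forward_rule_add_box[of "growth c x y" "growth c (Suc x) y" "growth c x (Suc y)" "of_bool ((Suc x, Suc y) \<in> c)"]
        growth_below_dot[OF assms, of x y] growth_left_of_dot[OF assms, of x y]
      by (auto simp: growth_Suc_Suc[OF assms])
  qed auto
  then show ?case
    using Suc forward_rule_add_box[of "growth c x y" "growth c (Suc x) y" "growth c x (Suc y)" "of_bool ((Suc x, Suc y) \<in> c)" for y]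
      growth_below_dot[OF assms, of x] growth_left_of_dot[OF assms, of x]
    by (auto simp: growth_Suc_Suc[OF assms])
qed auto

lemma partition_growth: "rook c \<Longrightarrow> partition (growth c x y)"
  and add_box_growth_row: "rook c \<Longrightarrow> add_box (growth c x y) (growth c x (Suc y))"
  using partition_add_box_growth by blast+

lemma add_box_growth_column: "rook c \<Longrightarrow> add_box (growth c x y) (growth c (Suc x) y)"
  using add_box_growth_row[of "c\<inverse>" y x] by (simp add: growth_converse)

section \<open>Inverting the local rule\<close>

definition backward_rule :: "(nat \<Rightarrow> nat) \<Rightarrow> (nat \<Rightarrow> nat) \<Rightarrow> (nat \<Rightarrow> nat) \<Rightarrow> nat \<Rightarrow> nat" where
  "backward_rule \<kappa> \<mu> \<nu> r = min (\<mu> r) (\<nu> r) - (\<kappa> (Suc r) - max (\<mu> (Suc r)) (\<nu> (Suc r)))"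

text \<open>The bracket subtracted in row \<open>r\<close> is the amount that the forward rule
  pushed from row \<open>r\<close> into row \<open>Suc r\<close>. The bounds on
  \<open>\<rho>\<close> make the truncated differences exact.\<close>

lemma backward_rule_forward_rule:
  assumes "\<And>r. \<rho> r \<le> \<mu> r" "\<And>r. \<rho> r \<le> \<nu> r"
  shows "backward_rule (forward_rule d \<rho> \<mu> \<nu>) \<mu> \<nu> = \<rho>"
  using assms by (auto simp: backward_rule_def forward_rule_def fun_eq_iff)

lemma forward_rule_eqD:
  assumes "\<And>r. \<rho> r \<le> \<mu> r" "\<And>r. \<rho> r \<le> \<nu> r" "\<And>r. \<rho>' r \<le> \<mu> r" "\<And>r. \<rho>' r \<le> \<nu> r"
    and eq: "forward_rule d \<rho> \<mu> \<nu> = forward_rule d' \<rho>' \<mu> \<nu>"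
  shows "\<rho> = \<rho>' \<and> d = d'"
proof
  show "\<rho> = \<rho>'"
    using backward_rule_forward_rule[of \<rho> \<mu> \<nu> d] backward_rule_forward_rule[of \<rho>' \<mu> \<nu> d'] assms
    by simp
  show "d = d'" using fun_cong[OF eq, of 0] by (simp add: forward_rule_def)
qed

lemma partition_down:
  assumes "partition \<mu>" "\<mu> (Suc t) < \<mu> t"
  shows "partition (\<mu>(t := \<mu> t - 1))"
proof -
  obtain N where N: "\<mu> N = 0" using assms(1) by (auto simp: partition_def)
  then have "(\<mu>(t := \<mu> t - 1)) N = 0" using assms(2) by auto
  then have "\<exists>N. (\<mu>(t := \<mu> t - 1)) N = 0" by blast
  moreover have "(\<mu>(t := \<mu> t - 1)) (Suc r) \<le> (\<mu>(t := \<mu> t - 1)) r" for r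
    using assms(2) partitionD[OF assms(1), of r "Suc r"] by auto
  ultimately show ?thesis unfolding partition_altdef by blast
qed

text \<open>Each relation between the two last boxes reverses one case of the forward rule. A
  trivial step on one side makes the diagonal label equal to the opposite neighbour, boxes in
  different rows are both removed, and boxes in the same row are traced back one row.\<close>

lemma forward_rule_surj:
  assumes p: "partition \<mu>" "partition \<nu>" "partition \<kappa>" and s: "add_box \<mu> \<kappa>" "add_box \<nu> \<kappa>"
  obtains \<rho> d where "partition \<rho>" "add_box \<rho> \<mu>" "add_box \<rho> \<nu>" "forward_rule (of_bool d) \<rho> \<mu> \<nu> = \<kappa>"
    "d \<Longrightarrow> \<mu> = \<rho> \<and> \<nu> = \<rho>"
proof -
  consider "\<kappa> = \<mu>" | "\<kappa> = \<nu>"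
    | s t where "\<kappa> = \<mu>(s := Suc (\<mu> s))" "\<kappa> = \<nu>(t := Suc (\<nu> t))"
    using s unfolding add_box_def by metis
  then show thesis
  proof cases
    case 1
    then show thesis
      using that[of \<nu> False] p s forward_rule_0_right[of \<nu> \<mu>] add_box_le[OF s(2)] by simp
  next
    case 2
    then show thesis
      using that[of \<mu> False] p s forward_rule_0_left[of \<mu> \<nu>] add_box_le[OF s(1)] by simp
  next
    case (3 s t)
    show thesis
    proof (cases "s = t")
      case True
      have eq: "\<mu> r = \<nu> r" for r
        using fun_cong[OF 3(1), of r] fun_cong[OF 3(2), of r] True by (auto split: if_splits)
      then have \<nu>: "\<nu> = \<mu>" by auto
      show thesis
      proof (cases s)
        case 0
        \<comment> \<open>A box in the first row cannot have been bumped from a previous row, so it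
          stems from a dot.\<close>
        then show thesis using that[of \<mu> True] p \<nu> 3 forward_rule_1[of \<mu>] by simp
      next
        case (Suc u)
        \<comment> \<open>Row \<open>u\<close> has a removable box: it is still at least as long as
          row \<open>Suc u\<close> after the latter has grown.\<close>
        have lt: "\<mu> (Suc u) < \<mu> u"
          using partitionD[OF p(3), of u "Suc u"] 3(1) Suc by simp
        define \<rho> where "\<rho> = \<mu>(u := \<mu> u - 1)"
        have \<mu>: "\<mu> = \<rho>(u := Suc (\<rho> u))" using lt by (auto simp: \<rho>_def)
        have "partition \<rho>" unfolding \<rho>_def by (rule partition_down[OF p(1) lt])
        moreover have "forward_rule 0 \<rho> \<mu> \<mu> = \<kappa>"
          using forward_rule_same[of \<rho> u] 3(1) Suc unfolding \<mu>[symmetric] by (simp add: \<rho>_def)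
        moreover have "add_box \<rho> \<mu>" using add_box_upd[of \<rho> u] \<mu> by simp
        ultimately show thesis using that[of \<rho> False] \<nu> by simp
      qed
    next
      case False
      have \<mu>t: "\<mu> t = Suc (\<nu> t)" and \<nu>s: "\<nu> s = Suc (\<mu> s)"
        using fun_cong[OF 3(1), of t] fun_cong[OF 3(2), of t] fun_cong[OF 3(1), of s]
          fun_cong[OF 3(2), of s] False by auto
      have eq: "\<mu> r = \<nu> r" if "r \<noteq> s" "r \<noteq> t" for r
        using fun_cong[OF 3(1), of r] fun_cong[OF 3(2), of r] that by simp
      define \<rho> where "\<rho> = \<mu>(t := \<mu> t - 1)"
      have \<mu>: "\<mu> = \<rho>(t := Suc (\<rho> t))" using \<mu>t by (auto simp: \<rho>_def)
      have \<nu>: "\<nu> = \<rho>(s := Suc (\<rho> s))"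
        using \<mu>t \<nu>s eq False by (auto simp: \<rho>_def)
      \<comment> \<open>That the last box of row \<open>t\<close> is removable is read off
        \<open>\<nu>\<close>, a partition that already lacks it.\<close>
      have "\<mu> (Suc t) \<le> \<nu> (Suc t)" using eq[of "Suc t"] \<nu>s by (cases "Suc t = s") auto
      also have "\<dots> \<le> \<nu> t" by (rule partitionD[OF p(2)]) simp
      finally have "partition \<rho>" unfolding \<rho>_def using \<mu>t by (intro partition_down[OF p(1)]) simp
      moreover have "forward_rule 0 \<rho> \<mu> \<nu> = \<kappa>"
      proof -
        have "forward_rule 0 \<rho> \<mu> \<nu> = \<rho>(t := Suc (\<rho> t), s := Suc (\<rho> s))"
          using forward_rule_distinct[of t s \<rho>] False \<mu> \<nu> by metis
        moreover have "\<rho> s = \<mu> s" using False by (simp add: \<rho>_def)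
        ultimately show ?thesis using 3(1) \<mu> by metis
      qed
      moreover have "add_box \<rho> \<mu>" by (subst \<mu>) (rule add_box_upd)
      moreover have "add_box \<rho> \<nu>" by (subst \<nu>) (rule add_box_upd)
      ultimately show thesis using that[of \<rho> False] by simp
    qed
  qed
qed

section \<open>Conjugation of partitions\<close>

definition conjugate :: "(nat \<Rightarrow> nat) \<Rightarrow> nat \<Rightarrow> nat" where
  "conjugate \<rho> r = card {s. r < \<rho> s}"

text \<open>The counted set is an initial segment, so its size exceeds \<open>s\<close> iff it
  contains \<open>s\<close>. Both sides thus say that the diagram has a cell in row \<open>s\<close>
  and column \<open>r\<close>; this symmetry makes conjugation an involution.\<close>

lemma less_conjugate_iff:
  assumes "partition \<rho>"
  shows "s < conjugate \<rho> r \<longleftrightarrow> r < \<rho> s"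
proof -
  define N where "N = (LEAST N. \<rho> N \<le> r)"
  have "\<exists>N. \<rho> N \<le> r" using assms by (metis partition_def le0)
  then have "\<rho> N \<le> r" unfolding N_def by (rule LeastI_ex)
  moreover have "r < \<rho> s" if "s < N" for s
    using not_less_Least[of s "\<lambda>N. \<rho> N \<le> r"] that by (simp add: N_def)
  ultimately have "r < \<rho> s \<longleftrightarrow> s < N" for s
    using partitionD[OF assms, of N s] by (metis leD le_trans not_le)
  then show ?thesis by (simp add: conjugate_def)
qed

lemma finite_partition: "partition \<rho> \<Longrightarrow> finite {s. r < \<rho> s}"
  unfolding less_conjugate_iff[symmetric] by simp

lemma partition_conjugate:
  assumes "partition \<rho>"
  shows "partition (conjugate \<rho>)"
proof -
  have "conjugate \<rho> (Suc r) \<le> conjugate \<rho> r" for r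
    unfolding conjugate_def by (intro card_mono finite_partition assms) auto
  moreover have "conjugate \<rho> (\<rho> 0) = 0"
    using less_conjugate_iff[OF assms, of 0 "\<rho> 0"] by simp
  ultimately show ?thesis unfolding partition_altdef by blast
qed

lemma conjugate_conjugate:
  assumes "partition \<rho>"
  shows "conjugate (conjugate \<rho>) = \<rho>"
proof
  fix s
  have "r < conjugate (conjugate \<rho>) s \<longleftrightarrow> r < \<rho> s" for r
    by (simp add: less_conjugate_iff partition_conjugate assms)
  then show "conjugate (conjugate \<rho>) s = \<rho> s" by (metis less_irrefl linorder_neqE_nat)
qed

lemma conjugate_inj: "partition \<rho> \<Longrightarrow> partition \<mu> \<Longrightarrow> conjugate \<rho> = conjugate \<mu> \<longleftrightarrow> \<rho> = \<mu>"
  using conjugate_conjugate by metis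

lemma conjugate_zero [simp]: "conjugate (\<lambda>_. 0) = (\<lambda>_. 0)"
  by (auto simp: conjugate_def)

lemma add_box_conjugate:
  assumes "partition \<rho>" "add_box \<rho> \<mu>"
  shows "add_box (conjugate \<rho>) (conjugate \<mu>)"
  using assms(2)
proof (cases rule: stepE)
  case (2 s)
  \<comment> \<open>Counting from 0, the new box sits in row \<open>s\<close> and column
    \<open>\<rho> s\<close>, hence in row \<open>\<rho> s\<close> of the conjugate.\<close>
  have "conjugate \<mu> r = ((conjugate \<rho>)(\<rho> s := Suc (conjugate \<rho> (\<rho> s)))) r" for r
  proof (cases "r = \<rho> s")
    case True
    then have "{t. r < \<mu> t} = insert s {t. r < \<rho> t}" using 2 by auto
    then show ?thesis using True finite_partition[OF assms(1)] by (simp add: conjugate_def)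
  next
    case False
    then have "{t. r < \<mu> t} = {t. r < \<rho> t}" using 2 by auto
    then show ?thesis using False by (simp add: conjugate_def)
  qed
  then have "conjugate \<mu> = (conjugate \<rho>)(\<rho> s := Suc (conjugate \<rho> (\<rho> s)))" by blast
  then show ?thesis by simp
qed auto

text \<open>In a single part an edge may end at a skeleton cell, but its box then moves on to the
  next part. In the whole label the edge created by a dot therefore never dies, so a dot remains
  detectable at every greater height.\<close>

lemma growth_dot_column:
  assumes "rook c" "(Suc x, b) \<in> c" "0 < b" "b \<le> y"
  shows "growth c (Suc x) y \<noteq> growth c x y"
  using assms(4)
proof (induction y rule: dec_induct)
  case base
  obtain b' where b': "b = Suc b'" using assms(3) by (cases b) auto
  have "growth c (Suc x) b 0 = Suc (growth c x b 0)"
    using growth_below_dot[OF assms(1), of x b'] growth_left_of_dot[OF assms(1), of x b'] assms(2) b'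
    by (simp add: growth_Suc_Suc[OF assms(1)] forward_rule_def)
  then show ?case by force
next
  case (step y)
  show ?case
  proof
    assume eq: "growth c (Suc x) (Suc y) = growth c x (Suc y)"
    have "(Suc x, Suc y) \<notin> c" using rook_colD[OF assms(1,2)] step by fastforce
    then have f: "forward_rule 0 (growth c x y) (growth c (Suc x) y) (growth c x (Suc y)) = growth c x (Suc y)"
      using eq by (simp add: growth_Suc_Suc[OF assms(1)])
    \<comment> \<open>Part \<open>r\<close> shows that the lower neighbour does not exceed the left
      one there; part \<open>Suc r\<close> shows that nothing was bumped out of part
      \<open>r\<close>. So the edge one step below would be trivial too.\<close>
    have "growth c (Suc x) y r = growth c x y r" for r
      using fun_cong[OF f, of r] fun_cong[OF f, of "Suc r"] growth_Suc_left_le[of c x y r]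
        growth_Suc_right_le[of c x y r]
      by (auto simp: forward_rule_def split: nat.splits)
    then show False using step.IH by auto
  qed
qed

lemma growth_dot_row:
  assumes "rook c" "(a, Suc y) \<in> c" "0 < a" "a \<le> x"
  shows "growth c x (Suc y) \<noteq> growth c x y"
  using growth_dot_column[of "c\<inverse>" y a x] assms by (simp add: growth_converse)

section \<open>Boundary labels determine the placement\<close>

lemma ferrers_board_downD:
  "ferrers_board F \<Longrightarrow> (i, j) \<in> F \<Longrightarrow> 0 < i' \<Longrightarrow> i' \<le> i \<Longrightarrow> 0 < j' \<Longrightarrow> j' \<le> j \<Longrightarrow> (i', j') \<in> F"
  unfolding ferrers_board_def less_eq_Suc_le One_nat_def by blast

lemma ferrers_board_posD: "ferrers_board F \<Longrightarrow> (i, j) \<in> F \<Longrightarrow> 0 < i \<and> 0 < j"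
  unfolding ferrers_board_def less_eq_Suc_le One_nat_def by blast

lemma ferrers_board_finite: "ferrers_board F \<Longrightarrow> finite F"
  by (simp add: ferrers_board_def)

lemma ferrers_board_intro:
  assumes "finite F" "\<And>i j. (i, j) \<in> F \<Longrightarrow> 0 < i \<and> 0 < j"
    "\<And>i j i' j'. (i, j) \<in> F \<Longrightarrow> 0 < i' \<Longrightarrow> i' \<le> i \<Longrightarrow> 0 < j' \<Longrightarrow> j' \<le> j \<Longrightarrow> (i', j') \<in> F"
  shows "ferrers_board F"
  unfolding ferrers_board_def One_nat_def Suc_le_eq
  using assms(1,2) assms(3) by (intro conjI) (blast, blast, blast)

lemma ferrers_board_converse:
  assumes "ferrers_board F"
  shows "ferrers_board (F\<inverse>)"
proof (rule ferrers_board_intro)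
  show "(i', j') \<in> F\<inverse>" if "(i, j) \<in> F\<inverse>" "0 < i'" "i' \<le> i" "0 < j'" "j' \<le> j" for i j i' j'
    using ferrers_board_downD[OF assms, of j i j' i'] that by simp
qed (use ferrers_board_finite[OF assms] ferrers_board_posD[OF assms] in auto)

text \<open>A cell of maximal coordinate sum has no other cell weakly above and to the right of it,
  so deleting it leaves a Ferrers board.\<close>

lemma ferrers_board_induct [consumes 1, case_names empty insert]:
  assumes "ferrers_board F" "P {}"
    and ins: "\<And>F x y. ferrers_board F \<Longrightarrow> (Suc x, Suc y) \<notin> F \<Longrightarrow>
      ferrers_board (insert (Suc x, Suc y) F) \<Longrightarrow> P F \<Longrightarrow> P (insert (Suc x, Suc y) F)"
  shows "P F"
  using assms(1)
proof (induction "card F" arbitrary: F)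
  case 0
  then show ?case using assms(2) ferrers_board_finite by fastforce
next
  case (Suc n)
  note fin = ferrers_board_finite[OF Suc.prems]
  let ?h = "\<lambda>q :: nat \<times> nat. fst q + snd q"
  have "F \<noteq> {}" using Suc.hyps by auto
  then have "Max (?h ` F) \<in> ?h ` F" using fin by (intro Max_in) auto
  then obtain p where "p \<in> F" "?h p = Max (?h ` F)" by auto
  then have p: "p \<in> F" "\<And>q. q \<in> F \<Longrightarrow> ?h q \<le> ?h p"
    using fin by simp_all
  obtain x y where xy: "p = (Suc x, Suc y)"
    using ferrers_board_posD[OF Suc.prems, of "fst p" "snd p"] p(1)
    by (metis gr0_conv_Suc prod.collapse)
  have "ferrers_board (F - {p})"
  proof (rule ferrers_board_intro)
    fix i j i' j' assume *: "(i, j) \<in> F - {p}" "0 < i'" "i' \<le> i" "0 < j'" "j' \<le> j"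
    then have "(i', j') \<in> F" using Suc.prems by (auto intro: ferrers_board_downD)
    moreover have "(i', j') \<noteq> p" using * p(2)[of "(i, j)"] by auto
    ultimately show "(i', j') \<in> F - {p}" by simp
  qed (use fin ferrers_board_posD[OF Suc.prems] in auto)
  moreover have "P (F - {p})"
    using Suc.hyps calculation p(1) fin by (intro Suc.hyps(1)) simp_all
  moreover have "insert p (F - {p}) = F" using p(1) by blast
  ultimately show ?case using ins[of "F - {p}" x y] xy Suc.prems by simp
qed

text \<open>The axes count as corners of the board, hence the boundary is infinite, with zero labels far out.\<close>

definition boundary :: "(nat \<times> nat) set \<Rightarrow> (nat \<times> nat) set" where
  "boundary F = {(x, y). (x = 0 \<or> y = 0 \<or> (x, y) \<in> F) \<and> (Suc x, Suc y) \<notin> F}"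

lemma boundary_converse: "boundary (F\<inverse>) = (boundary F)\<inverse>"
  by (auto simp: boundary_def)

context
  fixes F x y
  assumes F: "ferrers_board F" "(Suc x, Suc y) \<notin> F" "ferrers_board (insert (Suc x, Suc y) F)"
begin

text \<open>One cell more replaces one boundary point by the diagonally opposite one, so a single
  local rule translates between the two boundary labellings.\<close>

lemma boundary_insert_corner: "boundary (insert (Suc x, Suc y) F) = insert (Suc x, Suc y) (boundary F - {(x, y)})"
proof -
  have "(Suc (Suc x), Suc (Suc y)) \<notin> F"
    using ferrers_board_downD[OF F(1), of "Suc (Suc x)" "Suc (Suc y)" "Suc x" "Suc y"] F(2) by auto
  then show ?thesis by (auto simp: boundary_def)
qed

lemma corner_diagonal_boundary: "(x, y) \<in> boundary F"
  using F(2) ferrers_board_downD[OF F(3), of "Suc x" "Suc y" x y] by (auto simp: boundary_def)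

lemma corner_below_boundary: "(Suc x, y) \<in> boundary F"
proof -
  have "(Suc (Suc x), Suc y) \<notin> F"
    using ferrers_board_downD[OF F(1), of "Suc (Suc x)" "Suc y" "Suc x" "Suc y"] F(2) by auto
  moreover have "y = 0 \<or> (Suc x, y) \<in> F"
    using ferrers_board_downD[OF F(3), of "Suc x" "Suc y" "Suc x" y] by auto
  ultimately show ?thesis by (simp add: boundary_def)
qed

lemma corner_left_boundary: "(x, Suc y) \<in> boundary F"
proof -
  have "(Suc x, Suc (Suc y)) \<notin> F"
    using ferrers_board_downD[OF F(1), of "Suc x" "Suc (Suc y)" "Suc x" "Suc y"] F(2) by auto
  moreover have "x = 0 \<or> (x, Suc y) \<in> F"
    using ferrers_board_downD[OF F(3), of "Suc x" "Suc y" x "Suc y"] by auto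
  ultimately show ?thesis by (simp add: boundary_def)
qed

lemma boundary_not_above_corner:
  assumes "(u, v) \<in> boundary F" shows "\<not> (Suc x \<le> u \<and> Suc y \<le> v)"
  using assms F(2) ferrers_board_downD[OF F(1), of u v "Suc x" "Suc y"] by (auto simp: boundary_def)

end

text \<open>At a corner cell the three known labels determine both the fourth label and the presence
  of a dot; the rest of the placement is then determined on the smaller board.\<close>

lemma growth_boundary_inj:
  assumes "ferrers_board F" "p \<subseteq> F" "q \<subseteq> F" "rook p" "rook q"
    "\<And>x y. (x, y) \<in> boundary F \<Longrightarrow> growth p x y = growth q x y"
  shows "p = q"
  using assms
proof (induction F arbitrary: p q rule: ferrers_board_induct)
  case empty
  then show ?case by simp
next
  case (insert F x y)
  note F = insert.hyps(1-3)
  note bds = corner_diagonal_boundary[OF F] corner_below_boundary[OF F] corner_left_boundary[OF F]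
  have bd': "(u, v) \<in> boundary (Set.insert (Suc x, Suc y) F) \<longleftrightarrow>
      (u, v) = (Suc x, Suc y) \<or> (u, v) \<in> boundary F \<and> (u, v) \<noteq> (x, y)" for u v
    unfolding boundary_insert_corner[OF F] by auto
  note eq = insert.prems(5)
  have "forward_rule (of_bool ((Suc x, Suc y) \<in> p)) (growth p x y) (growth p (Suc x) y) (growth p x (Suc y)) =
        forward_rule (of_bool ((Suc x, Suc y) \<in> q)) (growth q x y) (growth p (Suc x) y) (growth p x (Suc y))"
    using eq[of "Suc x" "Suc y"] eq[of "Suc x" y] eq[of x "Suc y"] bds
    by (simp add: bd' growth_Suc_Suc[OF insert.prems(3)] growth_Suc_Suc[OF insert.prems(4)])
  then have *: "growth p x y = growth q x y \<and>
      (of_bool ((Suc x, Suc y) \<in> p) :: nat) = of_bool ((Suc x, Suc y) \<in> q)"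
    using growth_Suc_left_le[of p x y] growth_Suc_right_le[of p x y]
      growth_Suc_left_le[of q x y] growth_Suc_right_le[of q x y] eq[of "Suc x" y] eq[of x "Suc y"] bds
    by (intro forward_rule_eqD) (auto simp: bd' growth_Suc_left_le growth_Suc_right_le)
  have "p \<inter> F = q \<inter> F"
  proof (rule insert.IH)
    fix u v assume uv: "(u, v) \<in> boundary F"
    \<comment> \<open>No boundary point of \<open>F\<close> dominates the new cell, so its dot does
      not influence the labels there.\<close>
    have restr: "growth (c \<inter> F) u v = growth c u v" if "c \<subseteq> Set.insert (Suc x, Suc y) F" for c
      using that boundary_not_above_corner[OF F uv] by (intro growth_cong) auto
    show "growth (p \<inter> F) u v = growth (q \<inter> F) u v"
      using restr insert.prems(1,2) uv eq[of u v] * by (cases "(u, v) = (x, y)") (auto simp: bd')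
  qed (use insert.prems in \<open>auto intro: rook_subset[OF _ Int_lower1]\<close>)
  then show ?case using * insert.prems(1,2) by (auto simp: of_bool_def split: if_splits)
qed

lemma rook_insert:
  assumes "rook c" "\<And>i. (i, b) \<notin> c" "\<And>j. (a, j) \<notin> c"
  shows "rook (insert (a, b) c)"
  using assms by (auto simp: rook_def single_valued_def)

lemma growth_boundary_surj:
  assumes "ferrers_board F"
    "\<And>x y. (x, y) \<in> boundary F \<Longrightarrow> partition (S x y)"
    "\<And>x y. (x, y) \<in> boundary F \<Longrightarrow> x = 0 \<or> y = 0 \<Longrightarrow> S x y = (\<lambda>_. 0)"
    "\<And>x y. (x, y) \<in> boundary F \<Longrightarrow> (Suc x, y) \<in> boundary F \<Longrightarrow> add_box (S x y) (S (Suc x) y)"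
    "\<And>x y. (x, y) \<in> boundary F \<Longrightarrow> (x, Suc y) \<in> boundary F \<Longrightarrow> add_box (S x y) (S x (Suc y))"
  shows "\<exists>q\<subseteq>F. rook q \<and> (\<forall>(x, y)\<in>boundary F. growth q x y = S x y)"
  using assms
proof (induction F arbitrary: S rule: ferrers_board_induct)
  case empty
  then show ?case
    by (intro exI[of _ "{}"]) (auto simp: boundary_def rook_def single_valued_def)
next
  case (insert F x y)
  note F = insert.hyps(1-3)
  note bds = corner_diagonal_boundary[OF F] corner_below_boundary[OF F] corner_left_boundary[OF F]
  let ?F' = "Set.insert (Suc x, Suc y) F"
  have bd': "(u, v) \<in> boundary ?F' \<longleftrightarrow>
      (u, v) = (Suc x, Suc y) \<or> (u, v) \<in> boundary F \<and> (u, v) \<noteq> (x, y)" for u v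
    unfolding boundary_insert_corner[OF F] by auto
  have in': "(Suc x, Suc y) \<in> boundary ?F'" "(Suc x, y) \<in> boundary ?F'" "(x, Suc y) \<in> boundary ?F'"
    using bds by (auto simp: bd')
  obtain \<rho> d where \<rho>: "partition \<rho>" "add_box \<rho> (S (Suc x) y)" "add_box \<rho> (S x (Suc y))"
    "forward_rule (of_bool d) \<rho> (S (Suc x) y) (S x (Suc y)) = S (Suc x) (Suc y)"
    "d \<Longrightarrow> S (Suc x) y = \<rho> \<and> S x (Suc y) = \<rho>"
    using forward_rule_surj[OF insert.prems(1)[OF in'(2)] insert.prems(1)[OF in'(3)] insert.prems(1)[OF in'(1)]
      insert.prems(4)[OF in'(2,1)] insert.prems(3)[OF in'(3,1)]] by metis
  \<comment> \<open>Labelling for the smaller board: the diagonal label obtained backwards takes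
    over from the corner that disappears.\<close>
  define S' where "S' u v = (if u = x \<and> v = y then \<rho> else S u v)" for u v
  have "\<exists>q\<subseteq>F. rook q \<and> (\<forall>(x, y)\<in>boundary F. growth q x y = S' x y)"
  proof (rule insert.IH)
    fix u v assume uv: "(u, v) \<in> boundary F"
    show "partition (S' u v)" using insert.prems(1)[of u v] uv \<rho>(1) by (auto simp: S'_def bd')
    show "S' u v = (\<lambda>_. 0)" if "u = 0 \<or> v = 0"
    proof (cases "(u, v) = (x, y)")
      case True
      \<comment> \<open>If \<open>(x, y)\<close> is on an axis, one of its two neighbours is on it
        as well; the zero label there bounds \<open>\<rho>\<close>.\<close>
      have "S (Suc x) y = (\<lambda>_. 0) \<or> S x (Suc y) = (\<lambda>_. 0)"
        using insert.prems(2)[OF in'(2)] insert.prems(2)[OF in'(3)] True that by auto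
      then have "\<rho> r = 0" for r
        using add_box_le[OF \<rho>(2), of r] add_box_le[OF \<rho>(3), of r] by auto
      then show ?thesis using True by (auto simp: S'_def)
    next
      case False
      then show ?thesis using insert.prems(2)[of u v] uv that by (auto simp: S'_def bd')
    qed
    \<comment> \<open>No boundary edge of \<open>F\<close> ends in \<open>(x, y)\<close>: the cells
      below and to the left of the new one, where they exist, lie in \<open>F\<close>. Only the two
      edges leaving \<open>(x, y)\<close> are affected by the relabelling.\<close>
    have nb: "(u, v) \<in> boundary F \<Longrightarrow> \<not> (u = x \<and> Suc v = y)" "(u, v) \<in> boundary F \<Longrightarrow> \<not> (Suc u = x \<and> v = y)"
      using ferrers_board_downD[OF F(3), of "Suc x" "Suc y" "Suc x" y]
        ferrers_board_downD[OF F(3), of "Suc x" "Suc y" x "Suc y"] by (auto simp: boundary_def)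
    show "add_box (S' u v) (S' (Suc u) v)" if "(Suc u, v) \<in> boundary F"
      using insert.prems(3)[of u v] uv that \<rho>(2) nb by (auto simp: S'_def bd')
    show "add_box (S' u v) (S' u (Suc v))" if "(u, Suc v) \<in> boundary F"
      using insert.prems(4)[of u v] uv that \<rho>(3) nb by (auto simp: S'_def bd')
  qed
  then obtain q where q: "q \<subseteq> F" "rook q" "\<And>u v. (u, v) \<in> boundary F \<Longrightarrow> growth q u v = S' u v"
    by blast
  define q' where "q' = (if d then Set.insert (Suc x, Suc y) q else q)"
  have "rook q'"
  proof (cases d)
    case True
    \<comment> \<open>A dot is prescribed only if both edges leaving \<open>(x, y)\<close> are
      trivial, and any other dot in its row or column would make one of them nontrivial.\<close>
    have e: "growth q (Suc x) y = growth q x y" "growth q x (Suc y) = growth q x y"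
      using q(3) bds \<rho>(5)[OF True] by (simp_all add: S'_def)
    have "(Suc x, b) \<notin> q" for b
    proof
      assume b: "(Suc x, b) \<in> q"
      then have "(Suc x, b) \<in> F" using q(1) by blast
      then have "0 < b" "b \<le> y"
        using ferrers_board_posD[OF F(1)] ferrers_board_downD[OF F(1), of "Suc x" b "Suc x" "Suc y"] F(2)
        by force+
      then show False using growth_dot_column[OF q(2) b] e(1) by blast
    qed
    moreover have "(a, Suc y) \<notin> q" for a
    proof
      assume a: "(a, Suc y) \<in> q"
      then have "(a, Suc y) \<in> F" using q(1) by blast
      then have "0 < a" "a \<le> x"
        using ferrers_board_posD[OF F(1)] ferrers_board_downD[OF F(1), of a "Suc y" "Suc x" "Suc y"] F(2)
        by force+
      then show False using growth_dot_row[OF q(2) a] e(2) by blast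
    qed
    ultimately show ?thesis using q(2) True unfolding q'_def by (simp add: rook_insert)
  qed (simp add: q'_def q)
  have same: "growth q' u v = S' u v" if "(u, v) \<in> boundary F" for u v
  proof -
    have "growth q' u v = growth q u v"
      using boundary_not_above_corner[OF F that] by (intro growth_cong) (auto simp: q'_def)
    then show ?thesis using q(3)[OF that] by simp
  qed
  have "(Suc x, Suc y) \<in> q' \<longleftrightarrow> d" using q(1) F(2) by (auto simp: q'_def)
  then have "growth q' (Suc x) (Suc y) = S (Suc x) (Suc y)"
    using same bds \<rho>(4) by (simp add: growth_Suc_Suc[OF \<open>rook q'\<close>] S'_def)
  then have "growth q' u v = S u v" if "(u, v) \<in> boundary ?F'" for u v
    using that same[of u v] by (auto simp: bd' S'_def)
  moreover have "q' \<subseteq> ?F'" using q(1) by (auto simp: q'_def)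
  ultimately show ?case using \<open>rook q'\<close> by blast
qed

section \<open>The involution conjugating all boundary labels\<close>

definition growth_conj :: "(nat \<times> nat) set \<Rightarrow> (nat \<times> nat) set \<Rightarrow> (nat \<times> nat) set" where
  "growth_conj F p = (THE q. q \<subseteq> F \<and> rook q \<and> (\<forall>(x, y)\<in>boundary F. growth q x y = conjugate (growth p x y)))"

text \<open>Every identity about the involution reduces to a comparison of boundary labels, in
  particular that it is its own inverse and commutes with inversion of placements.\<close>

lemma growth_conj_unique:
  assumes "ferrers_board F" "q \<subseteq> F" "rook q" "\<And>x y. (x, y) \<in> boundary F \<Longrightarrow> growth q x y = conjugate (growth p x y)"
  shows "growth_conj F p = q"
  unfolding growth_conj_def
proof (rule the_equality)
  show "q \<subseteq> F \<and> rook q \<and> (\<forall>(x, y)\<in>boundary F. growth q x y = conjugate (growth p x y))"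
    using assms by blast
  fix q' assume q': "q' \<subseteq> F \<and> rook q' \<and> (\<forall>(x, y)\<in>boundary F. growth q' x y = conjugate (growth p x y))"
  show "q' = q"
  proof (rule growth_boundary_inj[OF assms(1)])
    show "growth q' x y = growth q x y" if "(x, y) \<in> boundary F" for x y
      using q' assms(4)[OF that] that by auto
  qed (use q' assms in auto)
qed

context
  fixes F p
  assumes Fp: "ferrers_board F" "p \<subseteq> F" "rook p"
begin

lemma growth_conj_props:
  shows growth_conj_subset: "growth_conj F p \<subseteq> F"
    and rook_growth_conj: "rook (growth_conj F p)"
    and growth_growth_conj: "(x, y) \<in> boundary F \<Longrightarrow> growth (growth_conj F p) x y = conjugate (growth p x y)"
proof -
  have "\<exists>q\<subseteq>F. rook q \<and> (\<forall>(x, y)\<in>boundary F. growth q x y = conjugate (growth p x y))"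
    using Fp
    by (intro growth_boundary_surj) (auto intro: partition_conjugate partition_growth add_box_conjugate add_box_growth_row add_box_growth_column)
  then obtain q where q: "q \<subseteq> F" "rook q" "\<forall>(x, y)\<in>boundary F. growth q x y = conjugate (growth p x y)"
    by blast
  then have "growth_conj F p = q" using growth_conj_unique[OF Fp(1)] by blast
  then show "growth_conj F p \<subseteq> F" "rook (growth_conj F p)" "(x, y) \<in> boundary F \<Longrightarrow> growth (growth_conj F p) x y = conjugate (growth p x y)"
    using q by auto
qed

lemma growth_conj_growth_conj: "growth_conj F (growth_conj F p) = p"
  using Fp
  by (intro growth_conj_unique) (auto simp: growth_growth_conj conjugate_conjugate partition_growth)

lemma growth_conj_converse: "growth_conj (F\<inverse>) (p\<inverse>) = (growth_conj F p)\<inverse>"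
  using Fp growth_conj_subset rook_growth_conj growth_growth_conj
  by (intro growth_conj_unique ferrers_board_converse) (auto simp: boundary_converse growth_converse)

end

section \<open>Occupied rows and columns are preserved\<close>

lemma column_boundary:
  assumes "ferrers_board F" "(Suc x, j) \<in> F"
  obtains h where "(x, h) \<in> boundary F" "(Suc x, h) \<in> boundary F" "\<And>b. (Suc x, b) \<in> F \<Longrightarrow> 0 < b \<and> b \<le> h"
proof -
  have fin: "finite {b. (Suc x, b) \<in> F}"
    by (rule finite_subset[OF _ finite_Range[OF ferrers_board_finite[OF assms(1)]]]) blast
  define h where "h = Max {b. (Suc x, b) \<in> F}"
  have h: "(Suc x, h) \<in> F" using Max_in[OF fin] assms(2) unfolding h_def by blast
  have le: "b \<le> h" if "(Suc x, b) \<in> F" for b using Max_ge[OF fin] that unfolding h_def by blast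
  have n: "(Suc x, Suc h) \<notin> F" using le[of "Suc h"] by auto
  have "(Suc (Suc x), Suc h) \<notin> F" using n ferrers_board_downD[OF assms(1), of "Suc (Suc x)" "Suc h" "Suc x" "Suc h"]
    by auto
  moreover have "x = 0 \<or> h = 0 \<or> (x, h) \<in> F" using ferrers_board_downD[OF assms(1) h, of x h]
    by auto
  ultimately show thesis using that[of h] n h le ferrers_board_posD[OF assms(1)]
    by (auto simp: boundary_def)
qed

lemma Domain_iff_growth:
  assumes "rook p" "\<And>b. (Suc x, b) \<in> p \<Longrightarrow> 0 < b \<and> b \<le> h"
  shows "Suc x \<in> Domain p \<longleftrightarrow> growth p (Suc x) h \<noteq> growth p x h"
  using growth_dot_column[OF assms(1)] growth_empty_column[OF assms(1)] assms(2)
  by (metis Domain.simps)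

text \<open>Whether a column holds a dot shows at its top edge, which lies on the boundary: the two
  labels there differ iff it does. Conjugation is injective on partitions and preserves this
  difference.\<close>

lemma Domain_growth_conj:
  assumes "ferrers_board F" "p \<subseteq> F" "rook p"
  shows "Domain (growth_conj F p) = Domain p"
proof -
  have "i \<in> Domain (growth_conj F p) \<longleftrightarrow> i \<in> Domain p" for i
  proof (cases "i \<in> Domain F")
    case True
    then obtain j where j: "(i, j) \<in> F" by blast
    then obtain x where x: "i = Suc x" using ferrers_board_posD[OF assms(1) j] by (cases i) auto
    obtain h where h: "(x, h) \<in> boundary F" "(Suc x, h) \<in> boundary F" "\<And>b. (Suc x, b) \<in> F \<Longrightarrow> 0 < b \<and> b \<le> h"
      using column_boundary[OF assms(1) j[unfolded x]] by metis
    have "Suc x \<in> Domain (growth_conj F p) \<longleftrightarrow>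
        growth (growth_conj F p) (Suc x) h \<noteq> growth (growth_conj F p) x h"
      using h(3) growth_conj_subset[OF assms]
      by (intro Domain_iff_growth rook_growth_conj assms) blast
    also have "\<dots> \<longleftrightarrow> growth p (Suc x) h \<noteq> growth p x h"
      by (simp add: growth_growth_conj[OF assms] h conjugate_inj partition_growth assms)
    also have "\<dots> \<longleftrightarrow> Suc x \<in> Domain p"
      using h(3) assms(2) by (intro Domain_iff_growth[symmetric] assms) blast
    finally show ?thesis using x by simp
  next
    case False
    then show ?thesis using assms(2) growth_conj_subset[OF assms] by blast
  qed
  then show ?thesis by blast
qed

lemma Range_growth_conj:
  assumes "ferrers_board F" "p \<subseteq> F" "rook p"
  shows "Range (growth_conj F p) = Range p"
  using Domain_growth_conj[of "F\<inverse>" "p\<inverse>"] growth_conj_converse[OF assms] assms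
  by (auto simp: ferrers_board_converse)

section \<open>Transferring chain lengths through the boundary\<close>

lemma ex_boundary_above:
  assumes "ferrers_board F" "(x, y) \<in> F"
  obtains u v where "(u, v) \<in> boundary F" "(u, v) \<in> F" "x \<le> u" "y \<le> v"
proof -
  \<comment> \<open>Walk diagonally from \<open>(x, y)\<close>; the last point inside the board is a
    boundary point.\<close>
  let ?T = "{t. (x + t, y + t) \<in> F}"
  have "finite ((\<lambda>t. (x + t, y + t)) ` ?T)"
    by (rule finite_subset[OF _ ferrers_board_finite[OF assms(1)]]) blast
  then have fin: "finite ?T" by (rule finite_imageD) (simp add: inj_on_def)
  have "Max ?T \<in> ?T" using assms(2) by (intro Max_in fin) (auto intro!: exI[of _ 0])
  moreover have "Suc (Max ?T) \<notin> ?T" using Max_ge[OF fin] not_less_eq_eq by blast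
  ultimately show thesis using that[of "x + Max ?T" "y + Max ?T"] by (auto simp: boundary_def)
qed

text \<open>Conjugation controls only boundary labels. Conditions that persist when the corner moves
  up or right, such as having a long chain, can be tested there.\<close>

lemma ex_boundary_iff:
  assumes "ferrers_board F" "\<And>x y u v. P x y \<Longrightarrow> x \<le> u \<Longrightarrow> y \<le> v \<Longrightarrow> P u v"
  shows "(\<exists>(x, y)\<in>F. P x y) \<longleftrightarrow> (\<exists>(x, y)\<in>boundary F \<inter> F. P x y)"
proof
  assume "\<exists>(x, y)\<in>F. P x y"
  then obtain x y where xy: "(x, y) \<in> F" "P x y" by blast
  obtain u v where "(u, v) \<in> boundary F" "(u, v) \<in> F" "x \<le> u" "y \<le> v"
    using ex_boundary_above[OF assms(1) xy(1)] .
  then show "\<exists>(x, y)\<in>boundary F \<inter> F. P x y" using assms(2)[OF xy(2)] by blast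
qed blast

lemma dec_chain_mono:
  assumes "dec_chain c m x y" "x \<le> u" "y \<le> v"
  shows "dec_chain c m u v"
proof -
  obtain f g where "\<forall>i<m. (f i, g i) \<in> c \<and> f i \<le> x \<and> g i \<le> y"
    "\<forall>i. Suc i < m \<longrightarrow> f i < f (Suc i) \<and> g (Suc i) < g i"
    using assms(1) unfolding dec_chain_def by blast
  then show ?thesis
    unfolding dec_chain_def using assms(2,3) by (intro exI[of _ f] exI[of _ g]) fastforce
qed

lemma longest_incr_growth_conj_iff_dec_chain:
  assumes "ferrers_board F" "p \<subseteq> F" "rook p" "0 < m"
  shows "(\<exists>(x, y)\<in>F. m \<le> longest_incr (growth_conj F p) x y) \<longleftrightarrow> (\<exists>(x, y)\<in>F. dec_chain p m x y)"
proof -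
  obtain r where m: "m = Suc r" using assms(4) gr0_conv_Suc by blast
  have "m \<le> longest_incr (growth_conj F p) x y \<longleftrightarrow> dec_chain p m x y" if "(x, y) \<in> boundary F" for x y
  proof -
    have "m \<le> longest_incr (growth_conj F p) x y \<longleftrightarrow> r < conjugate (growth p x y) 0"
      using fun_cong[OF growth_growth_conj[OF assms(1-3) that], of 0]
      by (simp add: growth_def m Suc_le_eq)
    also have "\<dots> \<longleftrightarrow> 0 < growth p x y r"
      by (rule less_conjugate_iff[OF partition_growth[OF assms(3)]])
    also have "\<dots> \<longleftrightarrow> dec_chain p m x y"
      unfolding m using assms by (intro growth_pos_iff) (auto dest: ferrers_board_posD)
    finally show ?thesis .
  qed
  then have "(\<exists>(x, y)\<in>boundary F \<inter> F. m \<le> longest_incr (growth_conj F p) x y) \<longleftrightarrow>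
      (\<exists>(x, y)\<in>boundary F \<inter> F. dec_chain p m x y)"
    by (intro bex_cong) auto
  moreover have "(\<exists>(x, y)\<in>F. m \<le> longest_incr (growth_conj F p) x y) \<longleftrightarrow>
      (\<exists>(x, y)\<in>boundary F \<inter> F. m \<le> longest_incr (growth_conj F p) x y)"
  proof (rule ex_boundary_iff[OF assms(1)])
    show "m \<le> longest_incr (growth_conj F p) u v"
      if "m \<le> longest_incr (growth_conj F p) x y" "x \<le> u" "y \<le> v" for x y u v
      using that(1) longest_incr_mono[OF that(2,3)] by (rule le_trans)
  qed
  moreover have "(\<exists>(x, y)\<in>F. dec_chain p m x y) \<longleftrightarrow> (\<exists>(x, y)\<in>boundary F \<inter> F. dec_chain p m x y)"
  proof (rule ex_boundary_iff[OF assms(1)])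
    show "dec_chain p m u v" if "dec_chain p m x y" "x \<le> u" "y \<le> v" for x y u v
      using that by (rule dec_chain_mono)
  qed
  ultimately show ?thesis by simp
qed

section \<open>Pattern containment\<close>

lemma full_placement_iff:
  "full_placement L p \<longleftrightarrow> p \<subseteq> L \<and> rook p \<and> Domain p = Domain L \<and> Range p = Range L"
proof
  assume "full_placement L p"
  then have sub: "p \<subseteq> L" and col: "\<And>i. i \<in> Domain L \<Longrightarrow> \<exists>!j. (i, j) \<in> p"
    and row: "\<And>j. j \<in> Range L \<Longrightarrow> \<exists>!i. (i, j) \<in> p"
    unfolding full_placement_def by blast+
  have "j = j'" if "(i, j) \<in> p" "(i, j') \<in> p" for i j j'
    using col[of i] sub that by blast
  moreover have "i = i'" if "(i, j) \<in> p" "(i', j) \<in> p" for i i' j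
    using row[of j] sub that by blast
  ultimately have "rook p" by (auto simp: rook_def single_valued_def)
  moreover have "Domain L \<subseteq> Domain p" "Range L \<subseteq> Range p" using col row by blast+
  ultimately show "p \<subseteq> L \<and> rook p \<and> Domain p = Domain L \<and> Range p = Range L"
    using sub by blast
next
  assume *: "p \<subseteq> L \<and> rook p \<and> Domain p = Domain L \<and> Range p = Range L"
  then have "\<exists>!j. (i, j) \<in> p" if "i \<in> Domain L" for i
    using that rook_colD[of p i] by (metis DomainE)
  moreover have "\<exists>!i. (i, j) \<in> p" if "j \<in> Range L" for j
    using that * rook_rowD[of p _ j] by (metis RangeE)
  ultimately show "full_placement L p" using * by (simp add: full_placement_def)
qed

text \<open>The corner in the definition is the smallest one enclosing the chosen dots. Boards are
  closed downwards, so any enclosing corner in the board serves equally well.\<close>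

lemma contains_pattern_iff:
  assumes full: "full_placement L p" and L: "ferrers_board L" and ne: "\<tau> \<noteq> []"
  shows "contains_pattern L p \<tau> \<longleftrightarrow>
    (\<exists>f g. (\<forall>i<length \<tau>. (f i, g i) \<in> p) \<and> (\<forall>i j. i < j \<and> j < length \<tau> \<longrightarrow> f i < f j) \<and>
      (\<forall>i<length \<tau>. \<forall>j<length \<tau>. g i < g j \<longleftrightarrow> \<tau> ! i < \<tau> ! j) \<and>
      (\<exists>(x, y)\<in>L. \<forall>i<length \<tau>. f i \<le> x \<and> g i \<le> y))" (is "?lhs \<longleftrightarrow> ?rhs")
proof
  assume ?lhs
  then obtain c where c: "sorted_wrt (<) c" "set c \<subseteq> Domain L"
    "order_isomorphic (map (placement_perm p) c) \<tau>"
    "(last c, Max (set (map (placement_perm p) c))) \<in> L"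
    unfolding contains_pattern_def by blast
  have len: "length c = length \<tau>" using c(3) by (simp add: order_isomorphic_def)
  define f where "f = (!) c"
  define g where "g i = placement_perm p (f i)" for i
  have dot: "(f i, g i) \<in> p" if "i < length \<tau>" for i
  proof -
    have "f i \<in> Domain L" using c(2) len that unfolding f_def by (metis nth_mem subsetD)
    then show ?thesis using placement_perm_eq_iff[OF full, of "f i" "g i"] by (simp add: g_def)
  qed
  have mono: "f i < f j" if "i < j" "j < length \<tau>" for i j
    using c(1) that len by (simp add: f_def sorted_wrt_iff_nth_less)
  have iso: "g i < g j \<longleftrightarrow> \<tau> ! i < \<tau> ! j" if "i < length \<tau>" "j < length \<tau>" for i j
    using c(3) len that by (simp add: order_isomorphic_def f_def g_def)
  have "f i \<le> last c \<and> g i \<le> Max (set (map (placement_perm p) c))" if i: "i < length \<tau>" for i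
  proof
    have last: "last c = f (length \<tau> - 1)"
      using len ne last_conv_nth[of c] by (cases "c = []") (simp_all add: f_def)
    show "f i \<le> last c"
    proof (cases "i = length \<tau> - 1")
      case False
      then have "i < length \<tau> - 1" "length \<tau> - 1 < length \<tau>" using i by auto
      then show ?thesis using mono[of i "length \<tau> - 1"] last by simp
    qed (simp add: last)
    show "g i \<le> Max (set (map (placement_perm p) c))"
      using i len by (intro Max_ge) (auto simp: g_def f_def)
  qed
  then have "\<exists>(x, y)\<in>L. \<forall>i<length \<tau>. f i \<le> x \<and> g i \<le> y" using c(4) by blast
  then show ?rhs using dot mono iso by blast
next
  assume ?rhs
  then obtain f g x y where raw: "\<forall>i<length \<tau>. (f i, g i) \<in> p"
    "\<forall>i j. i < j \<and> j < length \<tau> \<longrightarrow> f i < f j"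
    "\<forall>i<length \<tau>. \<forall>j<length \<tau>. g i < g j \<longleftrightarrow> \<tau> ! i < \<tau> ! j"
    and L': "(x, y) \<in> L" and le: "\<forall>i<length \<tau>. f i \<le> x \<and> g i \<le> y"
    by blast
  have dot: "(f i, g i) \<in> p" if "i < length \<tau>" for i using raw(1) that by simp
  have mono: "f i < f j" if "i < j" "j < length \<tau>" for i j using raw(2) that by simp
  have iso: "g i < g j \<longleftrightarrow> \<tau> ! i < \<tau> ! j" if "i < length \<tau>" "j < length \<tau>" for i j
    using raw(3) that by simp
  define c where "c = map f [0..<length \<tau>]"
  have len: "length c = length \<tau>" by (simp add: c_def)
  have inL: "(f i, g i) \<in> L" if "i < length \<tau>" for i
    using dot[OF that] full by (auto simp: full_placement_def)
  have perm: "placement_perm p (f i) = g i" if "i < length \<tau>" for i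
    using placement_perm_eq_iff[OF full, of "f i" "g i"] inL[OF that] dot[OF that] by blast
  have map: "map (placement_perm p) c = map g [0..<length \<tau>]"
    using perm by (simp add: c_def)
  have "Max (g ` {0..<length \<tau>}) \<in> g ` {0..<length \<tau>}" using ne by (intro Max_in) auto
  then obtain s where s: "s < length \<tau>" "Max (g ` {0..<length \<tau>}) = g s" by auto
  have t: "length \<tau> - 1 < length \<tau>" using ne by simp
  have "last c = f (length \<tau> - 1)" using ne len by (simp add: c_def last_map)
  moreover have "(f (length \<tau> - 1), g s) \<in> L"
    using ferrers_board_posD[OF L inL[OF s(1)]] ferrers_board_posD[OF L inL[OF t]] le s(1) t
    by (intro ferrers_board_downD[OF L L']) auto
  moreover have "set (map (placement_perm p) c) = g ` {0..<length \<tau>}" unfolding map by simp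
  ultimately have "(last c, Max (set (map (placement_perm p) c))) \<in> L" using s(2) by simp
  moreover have "sorted_wrt (<) c" using mono by (simp add: c_def sorted_wrt_iff_nth_less)
  moreover have "set c \<subseteq> Domain L"
    unfolding c_def using DomainI[OF inL] by auto
  moreover have "order_isomorphic (map (placement_perm p) c) \<tau>"
    unfolding map order_isomorphic_def using iso by simp
  ultimately show ?lhs unfolding contains_pattern_def by blast
qed

lemma chain_strict:
  fixes f :: "nat \<Rightarrow> nat"
  assumes "\<And>i. Suc i < m \<Longrightarrow> f i < f (Suc i)" "i < j" "j < m"
  shows "f i < f j"
  using assms(2,3)
proof (induction j)
  case (Suc j)
  then show ?case using assms(1)[of j] by (cases "i = j") auto
qed auto

lemma chain_strict_down:
  fixes g :: "nat \<Rightarrow> nat"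
  assumes "\<And>i. Suc i < m \<Longrightarrow> g (Suc i) < g i" "i < j" "j < m"
  shows "g j < g i"
  using assms(2,3)
proof (induction j)
  case (Suc j)
  then show ?case using assms(1)[of j] by (cases "i = j") auto
qed auto

lemma decE:
  assumes "dec_chain c m x y"
  obtains f g where "\<And>i. i < m \<Longrightarrow> (f i, g i) \<in> c" "\<And>i. i < m \<Longrightarrow> f i \<le> x" "\<And>i. i < m \<Longrightarrow> g i \<le> y"
    "\<And>i j. i < j \<Longrightarrow> j < m \<Longrightarrow> f i < f j" "\<And>i j. i < m \<Longrightarrow> j < m \<Longrightarrow> g i < g j \<longleftrightarrow> j < i"
proof -
  obtain f g where fg: "\<forall>i<m. (f i, g i) \<in> c \<and> f i \<le> x \<and> g i \<le> y"
    "\<forall>i. Suc i < m \<longrightarrow> f i < f (Suc i) \<and> g (Suc i) < g i"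
    using assms unfolding dec_chain_def by blast
  have "f i < f j" if "i < j" "j < m" for i j
    using chain_strict[of m f i j] fg(2) that by blast
  moreover have g: "g j < g i" if "i < j" "j < m" for i j
    using chain_strict_down[of m g i j] fg(2) that by blast
  moreover have "g i < g j \<longleftrightarrow> j < i" if "i < m" "j < m" for i j
    using g[of i j] g[of j i] that by (cases i j rule: linorder_cases) auto
  ultimately show thesis using that[of f g] fg(1) by blast
qed

lemma decI:
  assumes "\<And>i. i < m \<Longrightarrow> (f i, g i) \<in> c" "\<And>i. i < m \<Longrightarrow> f i \<le> x" "\<And>i. i < m \<Longrightarrow> g i \<le> y"
    "\<And>i j. i < j \<Longrightarrow> j < m \<Longrightarrow> f i < f j" "\<And>i j. i < j \<Longrightarrow> j < m \<Longrightarrow> g j < g i"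
  shows "dec_chain c m x y"
  unfolding dec_chain_def using assms by (intro exI[of _ f] exI[of _ g]) auto

lemma rev_upt_nth: "i < m \<Longrightarrow> rev [Suc 0..<Suc m] ! i = m - i"
  by (simp add: rev_nth del: upt_Suc)

lemma contains_decreasing_pattern_iff:
  assumes "full_placement L p" "ferrers_board L" "0 < k"
  shows "contains_pattern L p (decreasing_pattern k) \<longleftrightarrow> (\<exists>(x, y)\<in>L. dec_chain p k x y)"
proof -
  have len: "length (decreasing_pattern k) = k" by (simp add: decreasing_pattern_def)
  have lt: "decreasing_pattern k ! i < decreasing_pattern k ! j \<longleftrightarrow> j < i" if "i < k" "j < k" for i j
    using that by (auto simp: decreasing_pattern_def rev_upt_nth simp del: upt_Suc)
  have ne: "decreasing_pattern k \<noteq> []" using len assms(3) by auto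
  have eq: "contains_pattern L p (decreasing_pattern k) \<longleftrightarrow>
    (\<exists>f g. (\<forall>i<k. (f i, g i) \<in> p) \<and> (\<forall>i j. i < j \<and> j < k \<longrightarrow> f i < f j) \<and>
      (\<forall>i<k. \<forall>j<k. g i < g j \<longleftrightarrow> j < i) \<and> (\<exists>(x, y)\<in>L. \<forall>i<k. f i \<le> x \<and> g i \<le> y))"
    unfolding contains_pattern_iff[OF assms(1,2) ne] len
    by (intro ex_cong1 conj_cong all_cong1 imp_cong refl) (simp only: lt)
  show ?thesis
  proof
    assume "contains_pattern L p (decreasing_pattern k)"
    then obtain f g x y where "\<forall>i<k. (f i, g i) \<in> p" "\<forall>i j. i < j \<and> j < k \<longrightarrow> f i < f j"
      "\<forall>i<k. \<forall>j<k. g i < g j \<longleftrightarrow> j < i" "(x, y) \<in> L" "\<forall>i<k. f i \<le> x \<and> g i \<le> y"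
      unfolding eq by blast
    then have "dec_chain p k x y" by (intro decI[of k f g]) auto
    then show "\<exists>(x, y)\<in>L. dec_chain p k x y" using \<open>(x, y) \<in> L\<close> by blast
  next
    assume "\<exists>(x, y)\<in>L. dec_chain p k x y"
    then obtain x y where xy: "(x, y) \<in> L" "dec_chain p k x y" by blast
    from xy(2) show "contains_pattern L p (decreasing_pattern k)"
    proof (rule decE)
      fix f g assume *: "\<And>i. i < k \<Longrightarrow> (f i, g i) \<in> p" "\<And>i. i < k \<Longrightarrow> f i \<le> x" "\<And>i. i < k \<Longrightarrow> g i \<le> y"
        "\<And>i j. i < j \<Longrightarrow> j < k \<Longrightarrow> f i < f j" "\<And>i j. i < k \<Longrightarrow> j < k \<Longrightarrow> g i < g j \<longleftrightarrow> j < i"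
      have "\<exists>(x, y)\<in>L. \<forall>i<k. f i \<le> x \<and> g i \<le> y" using xy(1) *(2,3) by blast
      then show ?thesis unfolding eq using *(1,4,5) by (intro exI[of _ f] exI[of _ g]) simp
    qed
  qed
qed

text \<open>The dot playing the maximum is both the rightmost and the highest one, so it is itself
  the corner of the rectangle and belongs to the board. Subtracting 1 from its positive coordinates
  expresses strictness.\<close>

lemma contains_decreasing_then_max_pattern_iff:
  assumes "full_placement L p" "ferrers_board L" "0 < m"
  shows "contains_pattern L p (decreasing_then_max_pattern (Suc m)) \<longleftrightarrow>
    (\<exists>(a, b)\<in>p. dec_chain p m (a - 1) (b - 1))"
proof -
  let ?\<tau> = "decreasing_then_max_pattern (Suc m)"
  have len: "length ?\<tau> = Suc m" by (simp add: decreasing_then_max_pattern_def)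
  have nth: "?\<tau> ! i = (if i < m then m - i else Suc m)" if "i < Suc m" for i
    using that
    by (auto simp: decreasing_then_max_pattern_def nth_append rev_upt_nth simp del: upt_Suc)
  have lt: "?\<tau> ! i < ?\<tau> ! j \<longleftrightarrow> (if j = m then i < m else j < i \<and> i < m)" if "i < Suc m" "j < Suc m" for i j
    using that by (auto simp: nth)
  have ne: "?\<tau> \<noteq> []" using len by auto
  have eq: "contains_pattern L p ?\<tau> \<longleftrightarrow>
    (\<exists>f g. (\<forall>i<Suc m. (f i, g i) \<in> p) \<and> (\<forall>i j. i < j \<and> j < Suc m \<longrightarrow> f i < f j) \<and>
      (\<forall>i<Suc m. \<forall>j<Suc m. g i < g j \<longleftrightarrow> (if j = m then i < m else j < i \<and> i < m)) \<and>
      (\<exists>(x, y)\<in>L. \<forall>i<Suc m. f i \<le> x \<and> g i \<le> y))"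
    unfolding contains_pattern_iff[OF assms(1,2) ne] len
    by (intro ex_cong1 conj_cong all_cong1 imp_cong refl) (simp only: lt)
  show ?thesis
  proof
    assume "contains_pattern L p ?\<tau>"
    then obtain f g where *: "\<forall>i<Suc m. (f i, g i) \<in> p" "\<forall>i j. i < j \<and> j < Suc m \<longrightarrow> f i < f j"
      "\<forall>i<Suc m. \<forall>j<Suc m. g i < g j \<longleftrightarrow> (if j = m then i < m else j < i \<and> i < m)"
      unfolding eq by blast
    have le: "f i \<le> f m - 1" "g i \<le> g m - 1" if "i < m" for i
    proof -
      have "f i < f m" "g i < g m" using *(2,3) that by auto
      then show "f i \<le> f m - 1" "g i \<le> g m - 1" by auto
    qed
    have "dec_chain p m (f m - 1) (g m - 1)"
    proof (rule decI[of m f g])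
      show "g j < g i" if "i < j" "j < m" for i j using *(3) that by auto
    qed (use *(1,2) le in auto)
    then show "\<exists>(a, b)\<in>p. dec_chain p m (a - 1) (b - 1)" using * by blast
  next
    assume "\<exists>(a, b)\<in>p. dec_chain p m (a - 1) (b - 1)"
    then obtain a b where ab: "(a, b) \<in> p" "dec_chain p m (a - 1) (b - 1)" by blast
    have abL: "(a, b) \<in> L" using ab(1) assms(1) by (auto simp: full_placement_def)
    note pos = ferrers_board_posD[OF assms(2) abL]
    from ab(2) show "contains_pattern L p ?\<tau>"
    proof (rule decE)
      fix f g assume *: "\<And>i. i < m \<Longrightarrow> (f i, g i) \<in> p" "\<And>i. i < m \<Longrightarrow> f i \<le> a - 1"
        "\<And>i. i < m \<Longrightarrow> g i \<le> b - 1"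
        "\<And>i j. i < j \<Longrightarrow> j < m \<Longrightarrow> f i < f j" "\<And>i j. i < m \<Longrightarrow> j < m \<Longrightarrow> g i < g j \<longleftrightarrow> j < i"
      have lt: "f i < a" "g i < b" if "i < m" for i
        using *(2,3)[OF that] pos by auto
      define f' where "f' = f(m := a)"
      define g' where "g' = g(m := b)"
      have "(f' i, g' i) \<in> p" if "i < Suc m" for i
        using that *(1) ab(1) by (auto simp: f'_def g'_def less_Suc_eq)
      moreover have "f' i < f' j" if "i < j" "j < Suc m" for i j
        using that *(4) lt(1) by (auto simp: f'_def less_Suc_eq)
      moreover have "g' i < g' j \<longleftrightarrow> (if j = m then i < m else j < i \<and> i < m)"
        if "i < Suc m" "j < Suc m" for i j
        using that *(5) lt(2)[of i] lt(2)[of j] by (auto simp: g'_def less_Suc_eq)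
      moreover have "f' i \<le> a \<and> g' i \<le> b" if "i < Suc m" for i
        using that lt[of i] by (auto simp: f'_def g'_def less_Suc_eq)
      then have "\<exists>(x, y)\<in>L. \<forall>i<Suc m. f' i \<le> x \<and> g' i \<le> y" using abL by blast
      ultimately show ?thesis unfolding eq by (intro exI[of _ f'] exI[of _ g']) simp
    qed
  qed
qed

section \<open>Patterns followed by a maximum\<close>

text \<open>A clash between a kept dot and a new one would already be a clash between two old dots,
  as the new dots occupy the same rows and columns as the old dots of \<open>S\<close>.\<close>

lemma rook_exchange:
  assumes "rook p" "rook q" "Domain q = Domain (p \<inter> S)" "Range q = Range (p \<inter> S)"
  shows "rook (p - S \<union> q)" "Domain (p - S \<union> q) = Domain p" "Range (p - S \<union> q) = Range p"
proof -
  have "j = j'" if "(i, j) \<in> p - S \<union> q" "(i, j') \<in> p - S \<union> q" for i j j'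
  proof -
    have False if d: "(i, j) \<in> p - S" "(i, j') \<in> q" for j j'
    proof -
      obtain l where "(i, l) \<in> p \<inter> S" using d(2) assms(3) by blast
      then show False using rook_colD[OF assms(1), of i j l] d(1) by blast
    qed
    then show ?thesis
      using that rook_colD[OF assms(1), of i j j'] rook_colD[OF assms(2), of i j j'] by blast
  qed
  moreover have "i = i'" if "(i, j) \<in> p - S \<union> q" "(i', j) \<in> p - S \<union> q" for i i' j
  proof -
    have False if d: "(i, j) \<in> p - S" "(i', j) \<in> q" for i i'
    proof -
      obtain l where "(l, j) \<in> p \<inter> S" using d(2) assms(4) by blast
      then show False using rook_rowD[OF assms(1), of i j l] d(1) by blast
    qed
    then show ?thesis
      using that rook_rowD[OF assms(1), of i j i'] rook_rowD[OF assms(2), of i j i'] by blast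
  qed
  ultimately show "rook (p - S \<union> q)" unfolding rook_def single_valued_def by blast
  show "Domain (p - S \<union> q) = Domain p" "Range (p - S \<union> q) = Range p"
    unfolding Domain_Un_eq Range_Un_eq assms(3,4) by blast+
qed

lemma longest_incr_last_dot:
  assumes "rook c" "0 < longest_incr c x y"
  obtains a b where "(Suc a, Suc b) \<in> c" "Suc (longest_incr c a b) = longest_incr c x y"
proof -
  have "\<exists>a b. (Suc a, Suc b) \<in> c \<and> Suc (longest_incr c a b) = longest_incr c x y"
    using assms
  proof (induction c x y rule: longest_incr.induct)
    case (3 c x y)
    show ?case
    proof (cases "(Suc x, Suc y) \<in> c")
      case True
      then show ?thesis
        using longest_incr_dot_left[OF 3(3) True] longest_incr_dot_right[OF 3(3) True]
        by (intro exI[of _ x] exI[of _ y]) simp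
    next
      case False
      then show ?thesis using 3 by (simp add: max_def split: if_splits)
    qed
  qed auto
  then show thesis using that by blast
qed

section \<open>The sub-board cut out by the dots and the involution inside it\<close>

definition shadow :: "(nat \<times> nat) set \<Rightarrow> (nat \<times> nat) set" where
  "shadow p = {(i, j). 0 < i \<and> 0 < j \<and> (\<exists>(a, b)\<in>p. i < a \<and> j < b)}"

lemma shadow_converse: "shadow (p\<inverse>) = (shadow p)\<inverse>"
  by (auto simp: shadow_def)

lemma shadow_subset: "ferrers_board L \<Longrightarrow> p \<subseteq> L \<Longrightarrow> shadow p \<subseteq> L"
  using ferrers_board_downD by (fastforce simp: shadow_def)

lemma ferrers_board_shadow:
  assumes "ferrers_board L" "p \<subseteq> L"
  shows "ferrers_board (shadow p)"
proof (rule ferrers_board_intro)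
  show "finite (shadow p)"
    using shadow_subset[OF assms] ferrers_board_finite[OF assms(1)] by (rule finite_subset)
  show "0 < i \<and> 0 < j" if "(i, j) \<in> shadow p" for i j
    using that by (simp add: shadow_def)
  show "(i', j') \<in> shadow p" if "(i, j) \<in> shadow p" "0 < i'" "i' \<le> i" "0 < j'" "j' \<le> j" for i j i' j'
    using that le_less_trans by (fastforce simp: shadow_def)
qed

text \<open>Among the dots strictly above and to the right of the cell, one of maximal coordinate
  sum has no dot beyond it. So the dots outside the sub-board alone generate it.\<close>

lemma shadow_outer_dot:
  assumes "finite p" "(i, j) \<in> shadow p"
  obtains a b where "(a, b) \<in> p - shadow p" "i < a" "j < b"
proof -
  let ?h = "\<lambda>q :: nat \<times> nat. fst q + snd q"
  let ?D = "{q \<in> p. i < fst q \<and> j < snd q}"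
  have "?D \<noteq> {}" using assms(2) by (force simp: shadow_def)
  then have "Max (?h ` ?D) \<in> ?h ` ?D" using assms(1) by (intro Max_in) auto
  then obtain d where d: "d \<in> ?D" "?h d = Max (?h ` ?D)" by auto
  have le: "?h q \<le> ?h d" if "q \<in> ?D" for q
    unfolding d(2) using assms(1) that by (intro Max_ge) auto
  obtain a b where ab: "d = (a, b)" by (cases d)
  have "(a, b) \<notin> shadow p"
  proof
    assume "(a, b) \<in> shadow p"
    then obtain a' b' where "(a', b') \<in> p" "a < a'" "b < b'" by (auto simp: shadow_def)
    then show False using le[of "(a', b')"] d(1) ab by simp
  qed
  then show thesis using that[of a b] d(1) ab by auto
qed

definition shadow_conj :: "(nat \<times> nat) set \<Rightarrow> (nat \<times> nat) set" where
  "shadow_conj p = p - shadow p \<union> growth_conj (shadow p) (p \<inter> shadow p)"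

context
  fixes L p
  assumes Lp: "ferrers_board L" "p \<subseteq> L" "rook p"
begin

lemma shadow_restrict:
  shows "ferrers_board (shadow p)" "p \<inter> shadow p \<subseteq> shadow p" "rook (p \<inter> shadow p)"
  using ferrers_board_shadow[OF Lp(1,2)] rook_subset[OF Lp(3)] by auto

lemmas growth_conj_shadow_subset = growth_conj_subset[OF shadow_restrict]

text \<open>The new dots lie in a set closed downwards and so generate nothing outside it; the fixed
  outer dots generate all of it.\<close>

lemma shadow_shadow_conj: "shadow (shadow_conj p) = shadow p"
proof
  show "shadow (shadow_conj p) \<subseteq> shadow p"
  proof
    fix c assume c: "c \<in> shadow (shadow_conj p)"
    obtain i j where ij: "c = (i, j)" by (cases c)
    obtain a b where ab: "(a, b) \<in> shadow_conj p" "i < a" "j < b" "0 < i" "0 < j"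
      using c ij by (auto simp: shadow_def)
    show "c \<in> shadow p"
    proof (cases "(a, b) \<in> p")
      case True
      then show ?thesis using ab ij by (auto simp: shadow_def)
    next
      case False
      then have "(a, b) \<in> shadow p" using ab(1) growth_conj_shadow_subset
        by (auto simp: shadow_conj_def)
      then show ?thesis
        using ferrers_board_downD[OF shadow_restrict(1), of a b i j] ab ij by simp
    qed
  qed
  show "shadow p \<subseteq> shadow (shadow_conj p)"
  proof
    fix c assume c: "c \<in> shadow p"
    obtain i j where ij: "c = (i, j)" by (cases c)
    have "finite p" using finite_subset[OF Lp(2) ferrers_board_finite[OF Lp(1)]] .
    then obtain a b where "(a, b) \<in> p - shadow p" "i < a" "j < b"
      using shadow_outer_dot c ij by blast
    then have "(a, b) \<in> shadow_conj p" "i < a" "j < b" by (auto simp: shadow_conj_def)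
    then show "c \<in> shadow (shadow_conj p)" using c ij unfolding shadow_def by blast
  qed
qed

lemma shadow_conj_Int_shadow: "shadow_conj p \<inter> shadow p = growth_conj (shadow p) (p \<inter> shadow p)"
  using growth_conj_shadow_subset by (auto simp: shadow_conj_def)

lemma shadow_conj_shadow_conj: "shadow_conj (shadow_conj p) = p"
proof -
  have "shadow_conj (shadow_conj p) = shadow_conj p - shadow p \<union> growth_conj (shadow p) (shadow_conj p \<inter> shadow p)"
    unfolding shadow_conj_def[of "shadow_conj p"] shadow_shadow_conj ..
  also have "\<dots> = shadow_conj p - shadow p \<union> (p \<inter> shadow p)"
    unfolding shadow_conj_Int_shadow growth_conj_growth_conj[OF shadow_restrict] ..
  also have "shadow_conj p - shadow p = p - shadow p"
    using growth_conj_shadow_subset by (auto simp: shadow_conj_def)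
  finally show ?thesis by blast
qed

lemma shadow_conj_subset: "shadow_conj p \<subseteq> L"
  using Lp(2) growth_conj_shadow_subset shadow_subset[OF Lp(1,2)] by (auto simp: shadow_conj_def)

lemma shadow_conj_exchange:
  shows rook_shadow_conj: "rook (shadow_conj p)" and Domain_shadow_conj: "Domain (shadow_conj p) = Domain p"
    and Range_shadow_conj: "Range (shadow_conj p) = Range p"
  unfolding shadow_conj_def
  by (intro rook_exchange Lp rook_growth_conj Domain_growth_conj Range_growth_conj shadow_restrict)+

lemma shadow_conj_converse: "shadow_conj (p\<inverse>) = (shadow_conj p)\<inverse>"
  using growth_conj_converse[OF shadow_restrict]
  by (auto simp: shadow_conj_def shadow_converse converse_Int[symmetric])

lemma longest_incr_Int_shadow: "(x, y) \<in> shadow p \<Longrightarrow> longest_incr (p \<inter> shadow p) x y = longest_incr p x y"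
  using ferrers_board_posD[OF Lp(1)] Lp(2)
  by (intro longest_incr_cong) (blast intro: ferrers_board_downD[OF shadow_restrict(1)])

lemma dec_chain_Int_shadow:
  assumes "(x, y) \<in> shadow p"
  shows "dec_chain (p \<inter> shadow p) m x y \<longleftrightarrow> dec_chain p m x y"
proof -
  have "(i, j) \<in> p \<inter> shadow p \<longleftrightarrow> (i, j) \<in> p" if "i \<le> x" "j \<le> y" for i j
    using ferrers_board_posD[OF Lp(1), of i j] Lp(2) that
      ferrers_board_downD[OF shadow_restrict(1) assms, of i j] by blast
  then have "(i, j) \<in> p \<inter> shadow p \<and> i \<le> x \<and> j \<le> y \<longleftrightarrow> (i, j) \<in> p \<and> i \<le> x \<and> j \<le> y" for i j
    by blast
  then show ?thesis unfolding dec_chain_def by simp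
qed

lemma shadow_pred: "(a, b) \<in> p \<Longrightarrow> 0 < a - 1 \<Longrightarrow> 0 < b - 1 \<Longrightarrow> (a - 1, b - 1) \<in> shadow p"
  by (force simp: shadow_def)

lemma ex_dec_chain_shadow_iff:
  assumes "0 < m"
  shows "(\<exists>(x, y)\<in>shadow p. dec_chain (p \<inter> shadow p) m x y) \<longleftrightarrow> (\<exists>(a, b)\<in>p. dec_chain p m (a - 1) (b - 1))"
proof
  assume "\<exists>(x, y)\<in>shadow p. dec_chain (p \<inter> shadow p) m x y"
  then obtain x y where xy: "(x, y) \<in> shadow p" "dec_chain p m x y" using dec_chain_Int_shadow
    by blast
  then obtain a b where "(a, b) \<in> p" "x < a" "y < b" by (auto simp: shadow_def)
  moreover have "dec_chain p m (a - 1) (b - 1)" using calculation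
    by (intro dec_chain_mono[OF xy(2)]) auto
  ultimately show "\<exists>(a, b)\<in>p. dec_chain p m (a - 1) (b - 1)" by blast
next
  assume "\<exists>(a, b)\<in>p. dec_chain p m (a - 1) (b - 1)"
  then obtain a b where ab: "(a, b) \<in> p" "dec_chain p m (a - 1) (b - 1)" by blast
  \<comment> \<open>A nonempty chain contains a dot with positive coordinates, which keeps the
    corner \<open>(a - 1, b - 1)\<close> off the axes.\<close>
  then obtain i j where ij: "(i, j) \<in> p" "i \<le> a - 1" "j \<le> b - 1"
    using assms unfolding dec_chain_def by blast
  then have "0 < i" "0 < j" using ferrers_board_posD[OF Lp(1), of i j] Lp(2) by blast+
  then have "(a - 1, b - 1) \<in> shadow p"
    using ij(2,3) by (intro shadow_pred[OF ab(1)]) linarith+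
  then show "\<exists>(x, y)\<in>shadow p. dec_chain (p \<inter> shadow p) m x y"
    using ab(2) dec_chain_Int_shadow by blast
qed

text \<open>Splitting off the last dot of an increasing chain leaves a chain in the sub-board;
  conversely a dot that generates a cell extends every chain ending at or before that cell.\<close>

lemma ex_longest_incr_shadow_iff:
  assumes "0 < m"
  shows "(\<exists>(x, y)\<in>shadow p. m \<le> longest_incr (p \<inter> shadow p) x y) \<longleftrightarrow> (\<exists>(x, y)\<in>L. Suc m \<le> longest_incr p x y)"
proof
  assume "\<exists>(x, y)\<in>shadow p. m \<le> longest_incr (p \<inter> shadow p) x y"
  then obtain x y where xy: "(x, y) \<in> shadow p" "m \<le> longest_incr p x y" using longest_incr_Int_shadow
    by fastforce
  then obtain a b where ab: "(a, b) \<in> p" "x < a" "y < b" by (auto simp: shadow_def)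
  then obtain a' b' where ab': "a = Suc a'" "b = Suc b'" by (metis less_imp_Suc_add)
  have "longest_incr p x y \<le> longest_incr p a' (Suc b')" using ab ab'
    by (intro longest_incr_mono) auto
  then have "Suc m \<le> longest_incr p a b" using xy(2) ab(1) ab' by simp
  then show "\<exists>(x, y)\<in>L. Suc m \<le> longest_incr p x y" using ab(1) Lp(2) by blast
next
  assume "\<exists>(x, y)\<in>L. Suc m \<le> longest_incr p x y"
  then obtain x y where xy: "Suc m \<le> longest_incr p x y" by blast
  obtain a b where ab: "(Suc a, Suc b) \<in> p" "Suc (longest_incr p a b) = longest_incr p x y"
    using longest_incr_last_dot[OF Lp(3), of x y] xy by (metis less_le_trans zero_less_Suc)
  have le: "m \<le> longest_incr p a b" using xy ab(2) by simp
  then have "0 < a" "0 < b" using assms by (cases a; cases b; simp)+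
  then have "(a, b) \<in> shadow p" using shadow_pred[OF ab(1)] by simp
  then show "\<exists>(x, y)\<in>shadow p. m \<le> longest_incr (p \<inter> shadow p) x y" using le longest_incr_Int_shadow
    by force
qed

end

section \<open>Composing the two involutions\<close>

lemma card_involution:
  assumes "\<And>p. p \<in> U \<Longrightarrow> f p \<in> U" "\<And>p. p \<in> U \<Longrightarrow> f (f p) = p" "\<And>p. p \<in> U \<Longrightarrow> P (f p) \<longleftrightarrow> Q p"
  shows "card {p \<in> U. Q p} = card {p \<in> U. P p}"
proof (rule bij_betw_same_card[of f])
  have "Q (f p)" if "p \<in> U" "P p" for p using assms(1,2,3)[of "f p"] assms(1,2)[OF that(1)] that
    by simp
  then show "bij_betw f {p \<in> U. Q p} {p \<in> U. P p}"
    by (intro bij_betw_byWitness[where f' = f]) (use assms in auto)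
qed

theorem theorem4:
  fixes k :: nat and L :: "(nat \<times> nat) set"
  assumes "k \<ge> 2" and "ferrers_board L" and "self_conjugate L"
  shows "card (symmetric_avoiders L (decreasing_pattern k)) =
         card (symmetric_avoiders L (decreasing_then_max_pattern k))"
proof -
  \<comment> \<open>\<open>m = k - 1\<close> is the length of the prefix before the maximum;
    \<open>k \<ge> 2\<close> makes it positive.\<close>
  obtain m where m: "k = Suc m" "0 < m" using assms(1) by (cases k) auto
  \<comment> \<open>Both involutions act on this set. The intermediate pattern \<open>12...k\<close>
    enters only through \<open>longest_incr\<close>.\<close>
  define U where "U = {p. full_placement L p \<and> symmetric_placement p}"
  have sc: "L\<inverse> = L" using assms(3) by (simp add: self_conjugate_def)
  have U: "p \<subseteq> L" "rook p" "p\<inverse> = p" "Domain p = Domain L" "Range p = Range L" if "p \<in> U" for p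
    using that by (auto simp: U_def full_placement_iff symmetric_placement_def)
  have UI: "p \<in> U" if "p \<subseteq> L" "rook p" "p\<inverse> = p" "Domain p = Domain L" "Range p = Range L" for p
    using that by (simp add: U_def full_placement_iff symmetric_placement_def)
  have "card (symmetric_avoiders L (decreasing_pattern k)) = card {p \<in> U. \<not> (\<exists>(x, y)\<in>L. dec_chain p k x y)}"
    unfolding symmetric_avoiders_def U_def
    using contains_decreasing_pattern_iff[OF _ assms(2), of _ k] m(1)
    by (intro arg_cong[of _ _ card]) auto
  also have "\<dots> = card {p \<in> U. \<not> (\<exists>(x, y)\<in>L. k \<le> longest_incr p x y)}"
  proof (rule card_involution[of _ "growth_conj L"])
    fix p assume "p \<in> U"
    note p = U[OF this]
    note growth_conj = growth_conj_subset rook_growth_conj Domain_growth_conj Range_growth_conj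
    \<comment> \<open>Self-conjugacy of the board is what turns compatibility with inversion into
      preservation of symmetry.\<close>
    have "(growth_conj L p)\<inverse> = growth_conj L p" using growth_conj_converse[OF assms(2) p(1,2)] sc p(3)
      by simp
    then show "growth_conj L p \<in> U" using growth_conj[OF assms(2) p(1,2)] p by (intro UI) auto
    show "growth_conj L (growth_conj L p) = p" by (rule growth_conj_growth_conj[OF assms(2) p(1,2)])
    show "\<not> (\<exists>(x, y)\<in>L. k \<le> longest_incr (growth_conj L p) x y) \<longleftrightarrow> \<not> (\<exists>(x, y)\<in>L. dec_chain p k x y)"
      using longest_incr_growth_conj_iff_dec_chain[OF assms(2) p(1,2)] m(1) by simp
  qed
  also have "\<dots> = card {p \<in> U. \<not> (\<exists>(a, b)\<in>p. dec_chain p m (a - 1) (b - 1))}"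
  proof (rule card_involution[of _ shadow_conj, symmetric])
    fix p assume "p \<in> U"
    note p = U[OF this]
    note shadow_conj = shadow_conj_subset rook_shadow_conj Domain_shadow_conj Range_shadow_conj
    have "(shadow_conj p)\<inverse> = shadow_conj p" using shadow_conj_converse[OF assms(2) p(1,2)] p(3)
      by simp
    then show "shadow_conj p \<in> U" using shadow_conj[OF assms(2) p(1,2)] p by (intro UI) auto
    show "shadow_conj (shadow_conj p) = p" by (rule shadow_conj_shadow_conj[OF assms(2) p(1,2)])
    \<comment> \<open>The last dot of an increasing chain is split off in the image
      \<open>shadow_conj p\<close>, not in \<open>p\<close>; the equality of the two sub-boards then
      leads back to \<open>p\<close>.\<close>
    have "(\<exists>(x, y)\<in>L. k \<le> longest_incr (shadow_conj p) x y) \<longleftrightarrow>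
        (\<exists>(x, y)\<in>shadow (shadow_conj p). m \<le> longest_incr (shadow_conj p \<inter> shadow (shadow_conj p)) x y)"
      unfolding m(1) using ex_longest_incr_shadow_iff[OF assms(2) shadow_conj(1,2)[OF assms(2) p(1,2)] m(2)]
      by simp
    also have "\<dots> \<longleftrightarrow> (\<exists>(x, y)\<in>shadow p. m \<le> longest_incr (growth_conj (shadow p) (p \<inter> shadow p)) x y)"
      unfolding shadow_shadow_conj[OF assms(2) p(1,2)] shadow_conj_Int_shadow[OF assms(2) p(1,2)] ..
    also have "\<dots> \<longleftrightarrow> (\<exists>(x, y)\<in>shadow p. dec_chain (p \<inter> shadow p) m x y)"
      by (rule longest_incr_growth_conj_iff_dec_chain[OF shadow_restrict[OF assms(2) p(1,2)] m(2)])
    also have "\<dots> \<longleftrightarrow> (\<exists>(a, b)\<in>p. dec_chain p m (a - 1) (b - 1))"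
      by (rule ex_dec_chain_shadow_iff[OF assms(2) p(1,2) m(2)])
    finally show "\<not> (\<exists>(x, y)\<in>L. k \<le> longest_incr (shadow_conj p) x y) \<longleftrightarrow>
        \<not> (\<exists>(a, b)\<in>p. dec_chain p m (a - 1) (b - 1))"
      by simp
  qed
  also have "\<dots> = card (symmetric_avoiders L (decreasing_then_max_pattern k))"
    unfolding symmetric_avoiders_def U_def m(1)
    using contains_decreasing_then_max_pattern_iff[OF _ assms(2) m(2)]
    by (intro arg_cong[of _ _ card]) auto
  finally show ?thesis .
qed

end
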